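(* Let $h:\mathbb{R}^n\to\mathbb{R}$ be differentiable and suppose there are constants $\omega,\vartheta>0$ such that for all $p_1,p_2\in\mathbb{R}^n$, $$(p_1-p_2)^T(\nabla h(p_1)-\nabla h(p_2))\ge\omega|p_1-p_2|^2,\qquad|\nabla h(p_1)-\nabla h(p_2)|\le\vartheta|p_1-p_2|,$$ and suppose that the unique minimizer of $h$ is $p_*=0$. Consider $N\ge n+1$ mobile agents $\dot p_i=v_i$, $p_i,v_i\in\mathbb{R}^n$, $i=1,\ldots,N$, with distributed controllers $v_i=v_i^e+v_i^f$, where $$v_i^f=-\frac1N\sum_{j=1}^Na_{ij}(p_i-p_j-d_{ij}),\qquad v_i^e=-c_0\,\sigma\left(\Big(\sum_{j=1}^Nd_{j0}d_{j0}^T\Big)^{-1}\delta_i\right),$$ $$\dot\delta_i=-(\delta_i-Nd_{i0}h(p_i))-\sum_{j=1}^Nb_{ij}(q_i-q_j),\qquad\dot q_i=\mu\sum_{j=1}^Nb_{ij}(\delta_i-\delta_j),$$ with $\delta_i,q_i\in\mathbb{R}^n$ and $d_{j0}=\frac1N\sum_{i=1}^Nd_{ji}$. Then for any $p_\epsilon>0$ one can find coefficients for the distributed controllers (nonnegative constants $a_{ij},b_{ij}$; constant vectors $d_{ij}\in\mathbb{R}^n$ with $d_{ij}=-d_{ji}$ and $\det(\sum_{j=1}^Nd_{j0}d_{j0}^T)>0$; positive constants $c_0,\mu$; and a saturated function $\sigma:\mathbb{R}^n\to\mathbb{R}^n$ with $\sigma(0)=0$ and $\sigma(r)^Tr>0$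 for $r\ne0$) such that, for all initial states, the closed-loop states $(p_i,\delta_i,q_i)_{i=1}^N$ remain bounded and the average position $p_0=\frac1N\sum_{i=1}^Np_i$ ultimately converges to the region $\{|p_0|\le p_\epsilon\}$.
   Context: $|\cdot|$ is the Euclidean norm. "Saturated" means bounded. "Ultimately converges to the region $\{|p_0|\le p_\epsilon\}$" means $\limsup_{t\to\infty}|p_0(t)|\le p_\epsilon$. Right-hand sides of the differential equations considered are understood to be locally Lipschitz (standing assumption for existence and uniqueness of solutions). *)

theory Defs
  imports "HOL-Analysis.Analysis"
begin

(* The finite type 'm indexes the agents, so N = CARD('m); a value of type real^'n^'m
   collects one vector of R^n per agent. *)

definition average :: "real^'n^'m \<Rightarrow> real^'n" where
  "average p = (1 / real CARD('m)) *\<^sub>R (\<Sum>i\<in>UNIV. p $ i)"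

(* the vector written d_{j0} *)
definition center_offset :: "('m::finite \<Rightarrow> 'm \<Rightarrow> real^'n) \<Rightarrow> 'm \<Rightarrow> real^'n" where
  "center_offset d j = (1 / real CARD('m)) *\<^sub>R (\<Sum>i\<in>UNIV. d j i)"

(* the matrix  sum_j d_{j0} d_{j0}^T *)
definition offset_matrix :: "('m::finite \<Rightarrow> 'm \<Rightarrow> real^'n) \<Rightarrow> real^'n^'n" where
  "offset_matrix d =
     (\<Sum>j\<in>UNIV. (columnvector (center_offset d j) :: real^1^'n) ** rowvector (center_offset d j))"

definition formation_input ::
  "('m::finite \<Rightarrow> 'm \<Rightarrow> real) \<Rightarrow> ('m \<Rightarrow> 'm \<Rightarrow> real^'n) \<Rightarrow> real^'n^'m \<Rightarrow> 'm \<Rightarrow> real^'n" where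
  "formation_input a d p i =
     - (1 / real CARD('m)) *\<^sub>R (\<Sum>j\<in>UNIV. a i j *\<^sub>R (p $ i - p $ j - d i j))"

definition seeking_input ::
  "real \<Rightarrow> (real^'n \<Rightarrow> real^'n) \<Rightarrow> ('m::finite \<Rightarrow> 'm \<Rightarrow> real^'n) \<Rightarrow> real^'n^'m \<Rightarrow> 'm \<Rightarrow> real^'n" where
  "seeking_input c\<^sub>0 \<sigma> d \<delta> i = - c\<^sub>0 *\<^sub>R \<sigma> (matrix_inv (offset_matrix d) *v (\<delta> $ i))"

definition closed_loop_solution ::
  "(real^'n \<Rightarrow> real) \<Rightarrow> ('m::finite \<Rightarrow> 'm \<Rightarrow> real) \<Rightarrow> ('m \<Rightarrow> 'm \<Rightarrow> real) \<Rightarrow> ('m \<Rightarrow> 'm \<Rightarrow> real^'n)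
     \<Rightarrow> real \<Rightarrow> real \<Rightarrow> (real^'n \<Rightarrow> real^'n)
     \<Rightarrow> (real \<Rightarrow> real^'n^'m) \<Rightarrow> (real \<Rightarrow> real^'n^'m) \<Rightarrow> (real \<Rightarrow> real^'n^'m) \<Rightarrow> bool" where
  "closed_loop_solution h a b d c\<^sub>0 \<mu> \<sigma> p \<delta> q \<longleftrightarrow>
     (\<forall>t\<ge>0. \<forall>i.
        ((\<lambda>s. p s $ i) has_vector_derivative
           seeking_input c\<^sub>0 \<sigma> d (\<delta> t) i + formation_input a d (p t) i) (at t within {0..}) \<and>
        ((\<lambda>s. \<delta> s $ i) has_vector_derivative
           - (\<delta> t $ i - (real CARD('m) * h (p t $ i)) *\<^sub>R center_offset d i)
           - (\<Sum>j\<in>UNIV. b i j *\<^sub>R (q t $ i - q t $ j))) (at t within {0..}) \<and>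
        ((\<lambda>s. q s $ i) has_vector_derivative
           \<mu> *\<^sub>R (\<Sum>j\<in>UNIV. b i j *\<^sub>R (\<delta> t $ i - \<delta> t $ j))) (at t within {0..}))"

end

theory Submission
  imports Defs
begin

text \<open>
  Take complete graphs for both networks, offsets \<open>d i j = \<rho> (\<xi> i - \<xi> j)\<close> with \<open>\<xi>\<close> centered and
  spanning, and the radial projection onto the unit ball as \<open>\<sigma>\<close>. Since
  \<open>\<Sum>i. (\<xi> i \<bullet> x) g i = x\<close> for the dual family \<open>g\<close>, the average of the estimator inputs is a finite
  difference approximation of the gradient at the center. Averages and disagreements of the estimator
  obey stable linear filters driven by the time derivative of these inputs. For
  \<open>\<rho> = \<epsilon> p\<^sub>\<epsilon>\<close> and \<open>c\<^sub>0 = \<epsilon>\<^sup>2 p\<^sub>\<epsilon>\<close> all errors are eventually at most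
  \<open>K \<epsilon> sqrt (p\<^sub>\<epsilon>\<^sup>2 + \<bar>p\<^sub>0\<bar>\<^sup>2)\<close>. So for small \<open>\<epsilon>\<close> strong monotonicity of the gradient makes
  \<open>\<bar>p\<^sub>0\<bar>\<^sup>2\<close> decrease at a uniform rate outside the ball of radius \<open>p\<^sub>\<epsilon>\<close>. Saturation does not
  interfere, because \<open>\<sigma>\<close> only rescales its argument.
\<close>

section \<open>Sublevel sets and stable filters\<close>

text \<open>The coefficients are fixed before the initial states, while \<open>h\<close> may grow
  quadratically and no bound on the center is available in advance, so uniform absolute error bounds
  are out of reach. Saturation is what helps: the speed is at most \<open>c\<close> in every state,
  hence \<open>sqrt (P^2 + norm center^2)\<close> changes slowly and can serve as the unit in which
  all filter errors are measured. The powers of \<epsilon> come from the division by the formation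
  size \<rho> in a finite difference. The Taylor remainder contributes
  \<open>\<rho>^2 / \<rho>\<close>, the formation error \<open>c / \<rho>\<close>, and the time
  derivative of the inputs again \<open>c / \<rho>\<close>; with
  \<open>\<rho> = \<epsilon> * P\<close> and \<open>c = \<epsilon> * \<rho>\<close> all three have
  order \<epsilon>. Their constants involve neither \<epsilon> nor the initial states, so \<epsilon>
  can be chosen after them. The inputs of different agents do not nearly agree, since each has size
  \<open>h / \<rho>\<close>. The integral action of \<open>q\<close> absorbs this disagreement, so
  that only the time derivative of the inputs remains as a disturbance.\<close>

lemma sublevel_invariant:
  fixes V :: "real \<Rightarrow> real"
  assumes der: "\<And>t. t \<ge> T \<Longrightarrow> (V has_real_derivative V' t) (at t within {T..})"
    and decr: "\<And>t. t \<ge> T \<Longrightarrow> V t > L \<Longrightarrow> V' t \<le> 0"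
    and init: "V T \<le> L" and "t \<ge> T"
  shows "V t \<le> L"
proof (rule ccontr)
  assume "\<not> V t \<le> L"
  then have Vt: "V t > L" by simp
  have cont: "continuous_on {T..} V"
    using der by (meson DERIV_continuous atLeast_iff continuous_on_eq_continuous_within)
  \<comment> \<open>Beyond the last time \<open>s\<close> in this set \<open>V\<close> exceeds
    \<open>L\<close>, so its derivative is nonpositive there; the mean value theorem between
    \<open>s\<close> and \<open>t\<close> then rules out a climb above \<open>L\<close>.\<close>
  define S where "S = {T..t} \<inter> V -` {..L}"
  have "closed S"
    unfolding S_def by (rule continuous_closed_preimage)
      (use cont continuous_on_subset in \<open>auto intro: continuous_on_subset\<close>)
  moreover have "S \<noteq> {}" "bdd_above S"
    using init \<open>t \<ge> T\<close> by (auto simp: S_def intro: bdd_aboveI[of _ t])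
  ultimately have "Sup S \<in> S" by (simp add: closed_contains_Sup)
  define s where "s = Sup S"
  have s: "T \<le> s" "s \<le> t" "V s \<le> L"
    using \<open>Sup S \<in> S\<close> by (auto simp: S_def s_def)
  with Vt have "s < t" by (metis not_le order_le_less)
  have above: "V r > L" if "s < r" "r \<le> t" for r
  proof (rule ccontr)
    assume "\<not> V r > L"
    then have "r \<in> S" using that s by (auto simp: S_def)
    then have "r \<le> s" unfolding s_def using \<open>bdd_above S\<close> by (rule cSup_upper)
    with that show False by simp
  qed
  have "\<exists>x\<in>{s<..<t}. V t - V s = V' x * (t - s)"
  proof (rule mvt_simple[OF \<open>s < t\<close>])
    fix x assume "s \<le> x" "x \<le> t"
    then show "(V has_derivative (*) (V' x)) (at x within {s..t})"
      using der[of x] s by (auto simp: has_field_derivative_def intro: has_derivative_subset)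
  qed
  then obtain x where x: "s < x" "x < t" "V t - V s = V' x * (t - s)" by auto
  have "V' x * (t - s) \<le> 0"
    using above[of x] x s decr[of x] by (intro mult_nonpos_nonneg) auto
  with x Vt s show False by linarith
qed

text \<open>Staying above \<open>L\<close> forever would force \<open>V\<close> below a line of
  slope \<open>- c\<close>, which eventually crosses \<open>L\<close>. Once \<open>V\<close> has
  entered the sublevel set, it cannot leave.\<close>

lemma eventually_sublevel:
  fixes V :: "real \<Rightarrow> real"
  assumes der: "\<And>t. t \<ge> T \<Longrightarrow> (V has_real_derivative V' t) (at t within {T..})"
    and decr: "\<And>t. t \<ge> T \<Longrightarrow> V t \<ge> L \<Longrightarrow> V' t \<le> - c"
    and "c > 0"
  shows "eventually (\<lambda>t. V t \<le> L) at_top"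
proof -
  have "\<exists>s\<ge>T. V s \<le> L"
  proof (rule ccontr)
    assume "\<not> ?thesis"
    then have above: "V s > L" if "s \<ge> T" for s using that by (meson not_le)
    have lin: "V s + c * (s - T) \<le> V T" if "s \<ge> T" for s
    proof (rule sublevel_invariant[where V = "\<lambda>t. V t + c * (t - T)" and V' = "\<lambda>t. V' t + c" and T = T])
      show "((\<lambda>t. V t + c * (t - T)) has_real_derivative V' t + c) (at t within {T..})"
        if "t \<ge> T" for t
        by (rule derivative_eq_intros der[OF that] refl | simp)+
      show "V' t + c \<le> 0" if "t \<ge> T" for t
        using decr[OF that] above[OF that] by simp
    qed (use that in auto)
    \<comment> \<open>The time at which the line of slope \<open>- c\<close> starting from
      \<open>V T\<close> reaches \<open>L\<close>.\<close>
    define s where "s = T + (V T - L) / c"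
    have "s \<ge> T" using above[of T] \<open>c > 0\<close> by (simp add: s_def)
    moreover have "c * (s - T) = V T - L" using \<open>c > 0\<close> by (simp add: s_def)
    ultimately show False using lin[of s] above[of s] by linarith
  qed
  then obtain s where s: "s \<ge> T" "V s \<le> L" by blast
  have "V t \<le> L" if "t \<ge> s" for t
  proof (rule sublevel_invariant[where V = V and T = s and V' = V'])
    show "(V has_real_derivative V' t) (at t within {s..})" if "t \<ge> s" for t
      by (rule DERIV_subset[OF der]) (use that s in auto)
    show "V' t \<le> 0" if "t \<ge> s" "V t > L" for t
      using decr[of t] that s \<open>c > 0\<close> by auto
  qed (use s that in auto)
  then show ?thesis by (auto simp: eventually_at_top_linorder)
qed

lemma has_real_derivative_norm_power2:
  fixes X :: "real \<Rightarrow> 'a::real_inner"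
  assumes "(X has_vector_derivative X') (at t within S)"
  shows "((\<lambda>s. (norm (X s))\<^sup>2) has_real_derivative 2 * (X t \<bullet> X')) (at t within S)"
proof -
  have "((\<lambda>s. X s \<bullet> X s) has_derivative (\<lambda>r. X t \<bullet> (r *\<^sub>R X') + (r *\<^sub>R X') \<bullet> X t)) (at t within S)"
    using assms unfolding has_vector_derivative_def by (intro has_derivative_inner)
  moreover have "(\<lambda>r. X t \<bullet> (r *\<^sub>R X') + (r *\<^sub>R X') \<bullet> X t) = (*) (2 * (X t \<bullet> X'))"
    by (rule ext) (simp add: inner_commute)
  ultimately show ?thesis
    by (simp add: has_field_derivative_def power2_norm_eq_inner)
qed

text \<open>The Lyapunov function is \<open>n^2\<close> with \<open>n = norm X / B\<close>. Decay
  contributes \<open>- 2 * l * n^2\<close>; the growth of \<open>B\<close> costs at most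
  \<open>l / 2 * n^2\<close>, and so does the forcing once \<open>n\<close> is at least
  \<open>4 * k / l\<close>. The net rate is \<open>- l * n^2\<close>, which explains both the factor
  4 and the admissible relative growth \<open>l / 4\<close>. A moving \<open>B\<close> is allowed
  because the forcing need not be bounded.\<close>

lemma stable_filter_eventually_le:
  fixes X W :: "real \<Rightarrow> 'a::real_inner" and B :: "real \<Rightarrow> real"
  assumes X: "\<And>t. t \<ge> 0 \<Longrightarrow> (X has_vector_derivative W t - l *\<^sub>R X t) (at t within {0..})"
    and B: "\<And>t. t \<ge> 0 \<Longrightarrow> (B has_real_derivative B' t) (at t within {0..})"
    and Bpos: "\<And>t. t \<ge> 0 \<Longrightarrow> B t > 0"
    and B': "\<And>t. t \<ge> 0 \<Longrightarrow> \<bar>B' t\<bar> \<le> l / 4 * B t"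
    and W: "eventually (\<lambda>t. norm (W t) \<le> k * B t) at_top"
    and "l > 0" "k > 0"
  shows "eventually (\<lambda>t. norm (X t) \<le> 4 * k / l * B t) at_top"
proof -
  obtain T0 where T0: "\<And>t. t \<ge> T0 \<Longrightarrow> norm (W t) \<le> k * B t"
    using W by (auto simp: eventually_at_top_linorder)
  define T where "T = max 0 T0"
  have WT: "norm (W t) \<le> k * B t" and "t \<ge> 0" if "t \<ge> T" for t
    using T0 that by (auto simp: T_def)
  define V' where "V' t = (2 * (X t \<bullet> (W t - l *\<^sub>R X t)) * (B t)\<^sup>2
      - (norm (X t))\<^sup>2 * (2 * B t * B' t)) / ((B t)\<^sup>2 * (B t)\<^sup>2)" for t
  have "eventually (\<lambda>t. (norm (X t))\<^sup>2 / (B t)\<^sup>2 \<le> (4 * k / l)\<^sup>2) at_top"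
  proof (rule eventually_sublevel)
    fix t assume t: "t \<ge> T"
    have t0: "t \<ge> 0" using t by (simp add: T_def)
    have "((\<lambda>s. (norm (X s))\<^sup>2) has_real_derivative 2 * (X t \<bullet> (W t - l *\<^sub>R X t))) (at t within {0..})"
      by (rule has_real_derivative_norm_power2[OF X[OF t0]])
    moreover have "((\<lambda>s. (B s)\<^sup>2) has_real_derivative 2 * B t * B' t) (at t within {0..})"
      by (rule derivative_eq_intros B[OF t0] refl | simp)+
    ultimately have "((\<lambda>t. (norm (X t))\<^sup>2 / (B t)\<^sup>2) has_real_derivative V' t) (at t within {0..})"
      unfolding V'_def by (rule DERIV_divide) (use Bpos[OF t0] in auto)
    then show "((\<lambda>t. (norm (X t))\<^sup>2 / (B t)\<^sup>2) has_real_derivative V' t) (at t within {T..})"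
      by (rule DERIV_subset) (simp add: T_def)
    assume big: "(norm (X t))\<^sup>2 / (B t)\<^sup>2 \<ge> (4 * k / l)\<^sup>2"
    define n where "n = norm (X t) / B t"
    have nX: "norm (X t) = n * B t" using Bpos[OF t0] by (simp add: n_def)
    have "n \<ge> 0" using Bpos[OF t0] by (simp add: n_def)
    have "(4 * k / l)\<^sup>2 \<le> n\<^sup>2" using big by (simp add: n_def power_divide)
    then have n: "4 * k / l \<le> n" using \<open>n \<ge> 0\<close> by (rule power2_le_imp_le)
    then have kn: "4 * k \<le> l * n" using \<open>l > 0\<close> by (simp add: field_simps)
    have "X t \<bullet> W t \<le> norm (X t) * norm (W t)" by (rule norm_cauchy_schwarz)
    also have "\<dots> \<le> (n * B t) * (k * B t)"
      unfolding nX using WT[OF t] \<open>n \<ge> 0\<close> Bpos[OF t0] by (intro mult_left_mono) auto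
    finally have 1: "X t \<bullet> W t \<le> n * k * (B t)\<^sup>2" by (simp add: power2_eq_square mult_ac)
    have "2 * B t * (- B' t) \<le> 2 * B t * (l / 4 * B t)"
      using B'[OF t0] Bpos[OF t0] by (intro mult_left_mono) auto
    then have 2: "- (2 * B t * B' t) \<le> l / 2 * (B t)\<^sup>2" by (simp add: power2_eq_square)
    have "2 * (X t \<bullet> (W t - l *\<^sub>R X t)) * (B t)\<^sup>2 - (norm (X t))\<^sup>2 * (2 * B t * B' t)
        = 2 * (X t \<bullet> W t) * (B t)\<^sup>2 - 2 * l * (norm (X t))\<^sup>2 * (B t)\<^sup>2 + (norm (X t))\<^sup>2 * (- (2 * B t * B' t))"
      by (simp add: inner_diff_right power2_norm_eq_inner algebra_simps)
    also have "\<dots> \<le> 2 * (n * k * (B t)\<^sup>2) * (B t)\<^sup>2 - 2 * l * (norm (X t))\<^sup>2 * (B t)\<^sup>2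
        + (norm (X t))\<^sup>2 * (l / 2 * (B t)\<^sup>2)"
      using 1 2 by (intro add_mono diff_mono mult_left_mono mult_right_mono) auto
    also have "\<dots> = (2 * n * k - 2 * l * n\<^sup>2 + l / 2 * n\<^sup>2) * ((B t)\<^sup>2 * (B t)\<^sup>2)"
      by (simp add: nX power2_eq_square algebra_simps)
    finally have "V' t \<le> 2 * n * k - 2 * l * n\<^sup>2 + l / 2 * n\<^sup>2"
      unfolding V'_def using Bpos[OF t0] by (simp add: divide_le_eq)
    also have "\<dots> \<le> - l * n\<^sup>2"
    proof -
      have "n * (4 * k) \<le> n * (l * n)" using kn \<open>n \<ge> 0\<close> by (rule mult_left_mono)
      then have "2 * n * k \<le> l / 2 * n\<^sup>2" by (simp add: power2_eq_square algebra_simps)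
      then show ?thesis by (simp add: algebra_simps)
    qed
    also have "\<dots> \<le> - (l * (4 * k / l)\<^sup>2)"
      using \<open>(4 * k / l)\<^sup>2 \<le> n\<^sup>2\<close> \<open>l > 0\<close> by simp
    finally show "V' t \<le> - (l * (4 * k / l)\<^sup>2)" .
  qed (use \<open>l > 0\<close> \<open>k > 0\<close> in simp)
  moreover have "eventually (\<lambda>t::real. t \<ge> 0) at_top" by (rule eventually_ge_at_top)
  ultimately show ?thesis
  proof eventually_elim
    case (elim t)
    then have "(norm (X t) / B t)\<^sup>2 \<le> (4 * k / l)\<^sup>2" by (simp add: power_divide)
    then have "norm (X t) / B t \<le> 4 * k / l"
      by (rule power2_le_imp_le) (use \<open>l > 0\<close> \<open>k > 0\<close> in auto)
    then show ?case using Bpos[of t] elim by (simp add: pos_divide_le_eq)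
  qed
qed

section \<open>Radial saturation\<close>

definition saturate :: "real \<Rightarrow> 'a::real_normed_vector \<Rightarrow> 'a" where
  "saturate R x = (R / max R (norm x)) *\<^sub>R x"

lemma saturate_eq: "R > 0 \<Longrightarrow> norm x \<le> R \<Longrightarrow> saturate R x = x"
  by (simp add: saturate_def max_def)

lemma norm_saturate_le: "R > 0 \<Longrightarrow> norm (saturate R x) \<le> R"
  by (auto simp: saturate_def field_simps max_def abs_if)

text \<open>Split the difference into a change of the argument at fixed scale and a change of the
  scale at fixed argument; each contributes at most \<open>norm (x - y)\<close>.\<close>

lemma saturate_lipschitz:
  assumes R: "R > 0"
  shows "norm (saturate R x - saturate R y) \<le> 2 * norm (x - y)"
proof -
  define m n where "m = max R (norm x)" and "n = max R (norm y)"
  have mn: "m \<ge> R" "n \<ge> R" "m > 0" "n > 0" "norm y \<le> n" using R by (auto simp: m_def n_def)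
  have "\<bar>n - m\<bar> \<le> norm (x - y)"
    unfolding m_def n_def using norm_triangle_ineq2[of x y] norm_triangle_ineq2[of y x]
    by (auto simp: max_def abs_if norm_minus_commute)
  have "R / m = R / n + R * (n - m) / (m * n)"
    using mn by (simp add: field_simps)
  then have eq: "saturate R x - saturate R y = (R / m) *\<^sub>R (x - y) + (R * (n - m) / (m * n)) *\<^sub>R y"
    by (simp add: saturate_def m_def[symmetric] n_def[symmetric] scaleR_diff_right)
      (simp add: scaleR_left_distrib)
  have "norm ((R / m) *\<^sub>R (x - y)) \<le> 1 * norm (x - y)"
    unfolding norm_scaleR using mn R by (intro mult_right_mono) auto
  moreover have "norm ((R * (n - m) / (m * n)) *\<^sub>R y) = (R / m) * (\<bar>n - m\<bar> * (norm y / n))"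
    using R mn by (simp add: abs_mult)
  moreover have "\<dots> \<le> 1 * (norm (x - y) * 1)"
    using R mn \<open>\<bar>n - m\<bar> \<le> norm (x - y)\<close> by (intro mult_mono) auto
  ultimately show ?thesis
    unfolding eq using norm_triangle_ineq[of "(R / m) *\<^sub>R (x - y)" "(R * (n - m) / (m * n)) *\<^sub>R y"] by linarith
qed

section \<open>Global solutions of differential equations\<close>

lemma has_vector_derivative_integral_atLeast:
  fixes f :: "real \<Rightarrow> 'a::banach"
  assumes "continuous_on {a..} f" "t \<ge> a"
  shows "((\<lambda>u. integral {a..u} f) has_vector_derivative f t) (at t within {a..})"
proof -
  have "((\<lambda>u. integral {a..u} f) has_vector_derivative f t) (at t within {a..t + 1})"
    by (rule integral_has_vector_derivative) (use assms in \<open>auto intro: continuous_on_subset\<close>)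
  moreover have "at t within {a..t + 1} = at t within {a..}"
    by (rule at_within_nhd[where S = "{..<t + 1}"]) auto
  ultimately show ?thesis by simp
qed

text \<open>The Picard operator is a contraction for the sup norm weighted by
  \<open>exp (- 2 * integral {0..t} L)\<close>, so no continuation argument is needed.\<close>
lemma ode_global_solution:
  fixes F :: "real \<Rightarrow> 'a::banach \<Rightarrow> 'a" and L :: "real \<Rightarrow> real"
  assumes L: "continuous_on {0..} L" "\<And>t. t \<ge> 0 \<Longrightarrow> L t \<ge> 0"
    and cont: "\<And>z. continuous_on {0..} z \<Longrightarrow> continuous_on {0..} (\<lambda>t. F t (z t))"
    and lip: "\<And>t x y. t \<ge> 0 \<Longrightarrow> norm (F t x - F t y) \<le> L t * norm (x - y)"
    and zero: "\<And>t. t \<ge> 0 \<Longrightarrow> norm (F t 0) \<le> L t"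
  shows "\<exists>x. x 0 = x0 \<and> (\<forall>t\<ge>0. (x has_vector_derivative F t (x t)) (at t within {0..}))"
proof -
  define W where "W t = exp (2 * integral {0..t} L)" for t
  have W': "(W has_real_derivative 2 * L t * W t) (at t within {0..})" if "t \<ge> 0" for t
  proof -
    have "((\<lambda>u. integral {0..u} L) has_real_derivative L t) (at t within {0..})"
      using has_vector_derivative_integral_atLeast[OF L(1) that]
      by (simp add: has_real_derivative_iff_has_vector_derivative)
    then show ?thesis
      unfolding W_def by (auto intro!: derivative_eq_intros)
  qed
  have contW: "continuous_on {0..} W"
    by (meson W' DERIV_continuous atLeast_iff continuous_on_eq_continuous_within)
  have W0: "W 0 = 1" and Wpos: "W t > 0" for t by (simp_all add: W_def)
  have W1: "W t \<ge> 1" if "t \<ge> 0" for t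
  proof -
    have "L integrable_on {0..t}"
      by (rule integrable_continuous_real[OF continuous_on_subset[OF L(1)]]) auto
    then have "0 \<le> integral {0..t} L" by (rule integral_nonneg) (use L(2) in auto)
    then show ?thesis by (simp add: W_def)
  qed
  have WI: "((\<lambda>s. 2 * L s * W s) has_integral W t - W 0) {0..t}" if "t \<ge> 0" for t
  proof (rule fundamental_theorem_of_calculus[OF that])
    fix s assume "s \<in> {0..t}"
    then show "(W has_vector_derivative 2 * L s * W s) (at s within {0..t})"
      using W'[of s] by (auto simp: has_real_derivative_iff_has_vector_derivative
          intro: has_vector_derivative_within_subset)
  qed
  have WI_bound: "norm (integral {0..t} f) \<le> c * ((W t - 1) / 2)"
    if "t \<ge> 0" and f: "continuous_on {0..} f" "\<And>s. s \<ge> 0 \<Longrightarrow> norm (f s) \<le> c * (L s * W s)"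
    \<comment> \<open>Since \<open>2 * L * W\<close> is the derivative of \<open>W\<close>, the
      integral of \<open>L * W\<close> is \<open>(W t - 1) / 2\<close>; this half becomes the
      contraction constant.\<close>
    for t c and f :: "real \<Rightarrow> 'a"
  proof -
    have "((\<lambda>s. c / 2 * (2 * L s * W s)) has_integral c / 2 * (W t - W 0)) {0..t}"
      by (rule has_integral_mult_right[OF WI[OF that(1)]])
    then have I: "((\<lambda>s. c * (L s * W s)) has_integral c * ((W t - 1) / 2)) {0..t}"
      by (simp add: W0 mult_ac)
    have "f integrable_on {0..t}"
      by (rule integrable_continuous_real[OF continuous_on_subset[OF f(1)]]) auto
    then have "norm (integral {0..t} f) \<le> integral {0..t} (\<lambda>s. c * (L s * W s))"
      by (rule integral_norm_bound_integral) (use I f(2) in auto)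
    then show ?thesis unfolding integral_unique[OF I] .
  qed
  \<comment> \<open>The variable \<open>y\<close> is the candidate solution divided by
    \<open>W\<close>, which turns the weighted norm into the ordinary sup norm of bounded continuous
    functions.\<close>
  define G where "G y s = F s (W s *\<^sub>R apply_bcontfun y s)" for y s
  have contG: "continuous_on {0..} (G y)" for y :: "real \<Rightarrow>\<^sub>C 'a"
    unfolding G_def
    by (intro cont continuous_on_scaleR contW continuous_on_apply_bcontfun)
  define I where "I y t = x0 + integral {0..t} (G y)" for y t
  have I': "(I y has_vector_derivative G y t) (at t within {0..})" if "t \<ge> 0" for t and y
    unfolding I_def
    using has_vector_derivative_integral_atLeast[OF contG that, of y]
    by (auto intro!: derivative_eq_intros)
  have contI: "continuous_on {0..} (I y)" for y
    by (meson I' has_vector_derivative_continuous atLeast_iff continuous_on_eq_continuous_within)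
  \<comment> \<open>Bounded continuous functions live on the whole line here, so
    \<open>max 0 t\<close> continues the quotient to negative times by its value at 0.\<close>
  define N where "N y t = (1 / W (max 0 t)) *\<^sub>R I y (max 0 t)" for y t
  have "N y \<in> bcontfun" for y
    unfolding bcontfun_def mem_Collect_eq
  proof
    have *: "continuous_on UNIV (\<lambda>t. f (max 0 t))" if "continuous_on {0..} f"
      for f :: "real \<Rightarrow> 'b::topological_space"
      by (rule continuous_on_compose2[OF that]) (auto intro!: continuous_intros)
    show "continuous_on UNIV (N y)"
      unfolding N_def using Wpos by (intro continuous_intros * contI contW) (metis less_irrefl)
    obtain b where b: "\<And>s. norm (apply_bcontfun y s) \<le> b"
      using bounded_apply_bcontfun by (metis bounded_iff rangeI)
    have "norm (N y t) \<le> norm x0 + (1 + b)" for t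
    proof -
      define r where "r = max 0 t"
      have r: "r \<ge> 0" by (simp add: r_def)
      have b0: "b \<ge> 0" using b norm_ge_zero order_trans by blast
      have "norm (integral {0..r} (G y)) \<le> (1 + b) * ((W r - 1) / 2)"
      proof (rule WI_bound[OF r contG])
        fix s :: real assume s: "s \<ge> 0"
        have "norm (G y s) \<le> norm (F s 0) + norm (G y s - F s 0)"
          by (simp add: norm_triangle_sub)
        also have "\<dots> \<le> L s + L s * norm (W s *\<^sub>R apply_bcontfun y s)"
          unfolding G_def using zero[OF s] lip[OF s, of "W s *\<^sub>R apply_bcontfun y s" 0]
          by simp
        also have "\<dots> \<le> L s * W s + L s * (W s * b)"
          using mult_left_mono[OF W1[OF s] L(2)[OF s]] L(2)[OF s] Wpos[of s] b
          by (intro add_mono mult_left_mono) auto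
        finally show "norm (G y s) \<le> (1 + b) * (L s * W s)" by (simp add: algebra_simps)
      qed
      also have "\<dots> \<le> (1 + b) * W r"
        using b0 W1[OF r] by (intro mult_left_mono) auto
      finally have "norm (I y r) \<le> norm x0 + (1 + b) * W r"
        unfolding I_def by (smt (verit) norm_triangle_ineq)
      also have "\<dots> \<le> (norm x0 + (1 + b)) * W r"
        using mult_left_mono[OF W1[OF r] norm_ge_zero[of x0]] by (simp add: distrib_right)
      finally show ?thesis
        using Wpos[of r] by (simp add: N_def r_def[symmetric] divide_le_eq)
    qed
    then show "bounded (range (N y))" by (auto intro: boundedI)
  qed
  then have app: "apply_bcontfun (Bcontfun (N y)) = N y" for y by (rule Bcontfun_inverse)
  have "\<exists>!y. Bcontfun (N y) = y"
  proof (rule banach_fix_type[where c = "1/2"])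
    show "\<forall>y z. dist (Bcontfun (N y)) (Bcontfun (N z)) \<le> 1 / 2 * dist y z"
    proof (intro allI, rule dist_bound, unfold app)
      fix y z :: "real \<Rightarrow>\<^sub>C 'a" and t :: real
      define r where "r = max 0 t"
      have r: "r \<ge> 0" by (simp add: r_def)
      have int: "G y integrable_on {0..r}" for y
        by (rule integrable_continuous_real[OF continuous_on_subset[OF contG]]) auto
      have "I y r - I z r = integral {0..r} (\<lambda>s. G y s - G z s)"
        unfolding I_def by (simp add: integral_diff[OF int int])
      also have "norm \<dots> \<le> dist y z * ((W r - 1) / 2)"
      proof (rule WI_bound[OF r])
        show "continuous_on {0..} (\<lambda>s. G y s - G z s)" by (intro continuous_intros contG)
        fix s :: real assume s: "s \<ge> 0"
        have "norm (G y s - G z s) \<le> L s * norm (W s *\<^sub>R (apply_bcontfun y s - apply_bcontfun z s))"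
          unfolding G_def scaleR_diff_right by (rule lip[OF s])
        also have "\<dots> = L s * (W s * dist (apply_bcontfun y s) (apply_bcontfun z s))"
          using Wpos[of s] by (simp add: dist_norm)
        also have "\<dots> \<le> L s * (W s * dist y z)"
          using L(2)[OF s] Wpos[of s] by (intro mult_left_mono dist_bounded) auto
        finally show "norm (G y s - G z s) \<le> dist y z * (L s * W s)" by (simp add: mult_ac)
      qed
      also have "\<dots> \<le> 1 / 2 * dist y z * W r" using Wpos[of r] by (simp add: algebra_simps)
      finally have "norm (I y r - I z r) / W r \<le> 1 / 2 * dist y z"
        using Wpos[of r] by (simp add: pos_divide_le_eq)
      moreover have "dist (N y t) (N z t) = norm (I y r - I z r) / W r"
        using Wpos[of r] by (simp add: N_def r_def[symmetric] dist_norm flip: scaleR_diff_right)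
      ultimately show "dist (N y t) (N z t) \<le> 1 / 2 * dist y z" by simp
    qed
  qed auto
  then obtain y where "Bcontfun (N y) = y" by blast
  then have y: "apply_bcontfun y = N y" using app by metis
  have eq: "W t *\<^sub>R apply_bcontfun y t = I y t" if "t \<ge> 0" for t
    unfolding y N_def using that Wpos[of t] by (simp add: max_def)
  show ?thesis
  proof (intro exI conjI allI impI)
    show "I y 0 = x0" by (simp add: I_def)
    show "(I y has_vector_derivative F t (I y t)) (at t within {0..})" if "t \<ge> 0" for t
      using I'[OF that, of y] eq[OF that] by (simp add: G_def)
  qed
qed

section \<open>Formation error\<close>

definition mean :: "('m::finite \<Rightarrow> 'a::real_vector) \<Rightarrow> 'a" where
  "mean f = (1 / real CARD('m)) *\<^sub>R (\<Sum>i\<in>UNIV. f i)"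

lemma mean_diff: "mean (\<lambda>i. f i - g i) = mean f - mean g"
  and mean_uminus: "mean (\<lambda>i. - f i) = - mean f"
  and mean_scaleR: "mean (\<lambda>i. r *\<^sub>R f i) = r *\<^sub>R mean f"
  and mean_const: "mean (\<lambda>i. a) = a"
  by (simp_all add: mean_def sum_subtractf sum_negf scaleR_right_diff_distrib
      scaleR_left_commute[of r] sum_constant_scaleR flip: scaleR_sum_right)

lemma norm_mean_le:
  fixes f :: "'m::finite \<Rightarrow> 'a::real_normed_vector"
  assumes "\<And>i. norm (f i) \<le> k"
  shows "norm (mean f) \<le> k"
proof -
  have "norm (\<Sum>i\<in>UNIV. f i) \<le> real CARD('m) * k"
    using sum_norm_bound[of UNIV f k] assms by simp
  then show ?thesis by (simp add: mean_def pos_divide_le_eq mult.commute)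
qed

lemma inner_mean_ge:
  fixes f :: "'m::finite \<Rightarrow> 'a::real_inner"
  assumes "\<And>i. k \<le> x \<bullet> f i"
  shows "k \<le> x \<bullet> mean f"
proof -
  have "real CARD('m) * k \<le> (\<Sum>i\<in>UNIV. x \<bullet> f i)"
    using sum_bounded_below[of UNIV k "\<lambda>i. x \<bullet> f i"] assms by simp
  then show ?thesis by (simp add: mean_def inner_sum_right pos_le_divide_eq mult.commute)
qed

lemma has_vector_derivative_mean:
  fixes f :: "'m::finite \<Rightarrow> real \<Rightarrow> 'a::real_normed_vector"
  assumes "\<And>i. (f i has_vector_derivative f' i) F"
  shows "((\<lambda>t. mean (\<lambda>i. f i t)) has_vector_derivative mean f') F"
  unfolding mean_def
  by (intro bounded_linear.has_vector_derivative[OF bounded_linear_scaleR_right]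
      has_vector_derivative_sum assms)

lemma bounded_image_if_eventually_norm_le:
  fixes X :: "real \<Rightarrow> 'a::real_normed_vector"
  assumes "continuous_on {0..} X" and "eventually (\<lambda>t. norm (X t) \<le> k) at_top"
  shows "bounded (X ` {0..})"
proof -
  obtain T where T: "\<And>t. t \<ge> T \<Longrightarrow> norm (X t) \<le> k"
    using assms(2) by (auto simp: eventually_at_top_linorder)
  have "compact (X ` {0..T})"
    by (rule compact_continuous_image) (use assms(1) in \<open>auto intro: continuous_on_subset\<close>)
  then have "bounded (X ` {0..T} \<union> cball 0 k)"
    by (simp add: compact_imp_bounded)
  then show ?thesis
  proof (rule bounded_subset, intro image_subsetI)
    fix t :: real assume "t \<in> {0..}"
    then show "X t \<in> X ` {0..T} \<union> cball 0 k"
      using T[of t] by (cases "t \<le> T") auto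
  qed
qed

text \<open>Of the seeking input only the bound \<open>c\<close> is kept. The resulting estimates
  thus apply to the truncated equation of the existence proof as well as to the closed loop
  itself.\<close>

locale formation =
  fixes p s :: "'m::finite \<Rightarrow> real \<Rightarrow> 'a::real_inner" and w :: "'m \<Rightarrow> 'a" and c :: real
  assumes dp: "\<And>t i. t \<ge> 0 \<Longrightarrow> (p i has_vector_derivative
        s i t - (p i t - mean (\<lambda>j. p j t) - w i)) (at t within {0..})"
    and norm_s_le: "\<And>t i. t \<ge> 0 \<Longrightarrow> norm (s i t) \<le> c"
    and mean_w: "mean w = 0"
    and c_pos: "c > 0"
begin

definition center :: "real \<Rightarrow> 'a" where "center t = mean (\<lambda>i. p i t)"

definition err :: "'m \<Rightarrow> real \<Rightarrow> 'a" where "err i t = p i t - center t - w i"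

lemma d_p: "t \<ge> 0 \<Longrightarrow> (p i has_vector_derivative s i t - err i t) (at t within {0..})"
  using dp by (simp add: err_def center_def)

text \<open>The formation terms have mean zero, so only the seeking inputs move the center.\<close>

lemma d_center:
  assumes "t \<ge> 0"
  shows "(center has_vector_derivative mean (\<lambda>i. s i t)) (at t within {0..})"
proof -
  have "mean (\<lambda>i. err i t) = 0"
    unfolding err_def by (simp add: mean_diff mean_const mean_w) (simp add: center_def)
  then show ?thesis
    using has_vector_derivative_mean[OF d_p[OF assms], of "\<lambda>i. i"]
    by (simp add: center_def[abs_def] mean_diff)
qed

lemma norm_mean_s_le: "t \<ge> 0 \<Longrightarrow> norm (mean (\<lambda>i. s i t)) \<le> c"
  by (rule norm_mean_le) (rule norm_s_le)

lemma norm_s_diff_le: "t \<ge> 0 \<Longrightarrow> norm (s i t - mean (\<lambda>j. s j t)) \<le> 2 * c"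
  using norm_triangle_ineq4[of "s i t" "mean (\<lambda>j. s j t)"] norm_s_le[of t i] norm_mean_s_le[of t] by linarith

lemma d_err:
  assumes "t \<ge> 0"
  shows "(err i has_vector_derivative (s i t - mean (\<lambda>j. s j t)) - 1 *\<^sub>R err i t) (at t within {0..})"
proof -
  have "((\<lambda>t. p i t - center t - w i) has_vector_derivative
      (s i t - err i t) - mean (\<lambda>i. s i t) - 0) (at t within {0..})"
    by (intro has_vector_derivative_diff d_p d_center assms has_vector_derivative_const)
  then show ?thesis by (simp add: err_def[abs_def] algebra_simps)
qed

text \<open>The error is a filter of rate 1 with forcing at most \<open>2 * c\<close>, compared with
  the constant function 1; the filter bound multiplies the forcing by 4.\<close>

lemma eventually_norm_err_le: "eventually (\<lambda>t. norm (err i t) \<le> 8 * c) at_top"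
proof -
  have "eventually (\<lambda>t. norm (err i t) \<le> 4 * (2 * c) / 1 * 1) at_top"
  proof (rule stable_filter_eventually_le[where B = "\<lambda>_. 1" and B' = "\<lambda>_. 0"])
    show "eventually (\<lambda>t. norm (s i t - mean (\<lambda>j. s j t)) \<le> 2 * c * 1) at_top"
      using norm_s_diff_le by (auto simp: eventually_at_top_linorder intro!: exI[of _ 0])
  qed (use d_err c_pos in auto)
  then show ?thesis by simp
qed

text \<open>Existence of solutions needs a bound valid from time 0, at the price of the initial
  error. At any larger radius the decay outweighs the forcing \<open>2 * c\<close>.\<close>

lemma norm_err_le:
  assumes "t \<ge> 0"
  shows "norm (err i t) \<le> 2 * c + norm (err i 0)"
proof -
  have "(norm (err i t))\<^sup>2 \<le> (2 * c + norm (err i 0))\<^sup>2"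
  proof (rule sublevel_invariant[where V = "\<lambda>t. (norm (err i t))\<^sup>2" and T = 0])
    show "((\<lambda>t. (norm (err i t))\<^sup>2) has_real_derivative
        2 * (err i t \<bullet> ((s i t - mean (\<lambda>j. s j t)) - 1 *\<^sub>R err i t))) (at t within {0..})"
      if "t \<ge> 0" for t
      by (rule has_real_derivative_norm_power2[OF d_err[OF that]])
    show "2 * (err i t \<bullet> ((s i t - mean (\<lambda>j. s j t)) - 1 *\<^sub>R err i t)) \<le> 0"
      if t: "t \<ge> 0" and big: "(norm (err i t))\<^sup>2 > (2 * c + norm (err i 0))\<^sup>2" for t
    proof -
      have "norm (err i t) > 2 * c + norm (err i 0)"
        using big by (rule power2_less_imp_less) simp
      then have "norm (s i t - mean (\<lambda>j. s j t)) \<le> norm (err i t)"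
        using norm_s_diff_le[OF t, of i] norm_ge_zero[of "err i 0"] by linarith
      then have "norm (err i t) * norm (s i t - mean (\<lambda>j. s j t)) \<le> norm (err i t) * norm (err i t)"
        by (rule mult_left_mono) simp
      then have "err i t \<bullet> (s i t - mean (\<lambda>j. s j t)) \<le> err i t \<bullet> err i t"
        using norm_cauchy_schwarz[of "err i t" "s i t - mean (\<lambda>j. s j t)"]
        by (simp add: power2_norm_eq_inner flip: power2_eq_square)
      then show ?thesis by (simp add: inner_diff_right)
    qed
    show "(norm (err i 0))\<^sup>2 \<le> (2 * c + norm (err i 0))\<^sup>2"
      using c_pos by (intro power_mono) auto
  qed (use assms in auto)
  then show ?thesis by (rule power2_le_imp_le) (use c_pos in auto)
qed

lemma norm_p_le:
  assumes "t \<ge> 0"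
  shows "norm (p i t) \<le> norm (center 0) + norm (w i) + 2 * c + norm (err i 0) + c * t"
proof -
  have "norm (center t - center 0) \<le> c * norm (t - 0)"
  proof (rule differentiable_bound[where S = "{0..t}" and f' = "\<lambda>u r. r *\<^sub>R mean (\<lambda>i. s i u)"])
    fix u assume u: "u \<in> {0..t}"
    show "(center has_derivative (\<lambda>r. r *\<^sub>R mean (\<lambda>i. s i u))) (at u within {0..t})"
      using d_center[of u] u unfolding has_vector_derivative_def
      by (auto intro: has_derivative_subset)
    show "onorm (\<lambda>r. r *\<^sub>R mean (\<lambda>i. s i u)) \<le> c"
      by (rule onorm_bound) (use u norm_mean_s_le[of u] c_pos in \<open>auto simp: mult.commute[of c] intro: mult_left_mono\<close>)
  qed (use assms in auto)
  then have "norm (center t) \<le> norm (center 0) + c * t"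
    using assms norm_triangle_sub[of "center t" "center 0"] by simp
  moreover have "norm (p i t) \<le> norm (center t) + norm (w i) + norm (err i t)"
  proof -
    have "p i t = center t + w i + err i t" by (simp add: err_def)
    then show ?thesis by (metis norm_triangle_le norm_triangle_ineq add_mono order_refl)
  qed
  ultimately show ?thesis using norm_err_le[OF assms, of i] by linarith
qed

end

section \<open>Gradient estimation\<close>

lemma GDERIV_chain_within:
  assumes "GDERIV h (x t) :> D" "(x has_vector_derivative x') (at t within S)"
  shows "((\<lambda>s. h (x s)) has_real_derivative D \<bullet> x') (at t within S)"
proof -
  have "((\<lambda>s. h (x s)) has_derivative (\<lambda>r. (r *\<^sub>R x') \<bullet> D)) (at t within S)"
    using has_derivative_compose[OF assms(2)[unfolded has_vector_derivative_def] assms(1)[unfolded gderiv_def]] .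
  moreover have "(\<lambda>r. (r *\<^sub>R x') \<bullet> D) = (*) (D \<bullet> x')"
    by (auto simp: inner_commute)
  ultimately show ?thesis by (simp add: has_field_derivative_def)
qed

text \<open>The mean value theorem on the segment replaces the increment by a gradient at an
  intermediate point. This costs a factor 2 against integration along the segment, which would give
  \<open>\<theta> / 2\<close>.\<close>

lemma lipschitz_gradient_remainder_le:
  fixes h :: "'a::real_inner \<Rightarrow> real"
  assumes grad: "\<And>x. GDERIV h x :> D x"
    and lip: "\<And>x y. norm (D x - D y) \<le> \<theta> * norm (x - y)" and "\<theta> > 0"
  shows "\<bar>h (x + v) - h x - D x \<bullet> v\<bar> \<le> \<theta> * (norm v)\<^sup>2"
proof -
  have "((\<lambda>s. h (x + s *\<^sub>R v)) has_real_derivative D (x + s *\<^sub>R v) \<bullet> v) (at s within {0..1})" for s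
    by (rule GDERIV_chain_within[OF grad]) (auto intro!: derivative_eq_intros)
  then have "\<exists>s\<in>{0<..<1}. h (x + 1 *\<^sub>R v) - h (x + 0 *\<^sub>R v) = (D (x + s *\<^sub>R v) \<bullet> v) * (1 - 0)"
    by (intro mvt_simple) (auto simp: has_field_derivative_def)
  then obtain s where s: "0 < s" "s < 1" "h (x + v) - h x = D (x + s *\<^sub>R v) \<bullet> v" by auto
  then have "\<bar>h (x + v) - h x - D x \<bullet> v\<bar> = \<bar>(D (x + s *\<^sub>R v) - D x) \<bullet> v\<bar>"
    by (simp add: inner_diff_left)
  also have "\<dots> \<le> norm (D (x + s *\<^sub>R v) - D x) * norm v" by (rule Cauchy_Schwarz_ineq2)
  also have "\<dots> \<le> (\<theta> * (s * norm v)) * norm v"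
    using lip[of "x + s *\<^sub>R v" x] s by (intro mult_right_mono) auto
  also have "\<dots> \<le> (\<theta> * (1 * norm v)) * norm v"
    using s \<open>\<theta> > 0\<close> by (intro mult_right_mono mult_left_mono) auto
  finally show ?thesis by (simp add: power2_eq_square)
qed

text \<open>The signals \<open>y\<close> and \<open>z\<close> stand for \<open>\<delta>\<close> and \<open>q\<close> multiplied by the inverse of the offset matrix.
  The formation size \<open>\<rho>\<close> is of order \<open>\<epsilon>\<close> and the speed \<open>c\<close> of order \<open>\<epsilon>\<^sup>2\<close>; this makes every
  deviation of \<open>y i\<close> from the gradient at the center of order \<open>\<epsilon>\<close>, relative to \<open>B\<close> below.\<close>
locale seeking = formation p "\<lambda>i t. - c *\<^sub>R saturate 1 (y i t)" "\<lambda>i. \<rho> *\<^sub>R \<xi> i" c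
  for p y :: "'m::finite \<Rightarrow> real \<Rightarrow> 'a::real_inner" and \<xi> c \<rho> +
  fixes h :: "'a \<Rightarrow> real" and D :: "'a \<Rightarrow> 'a" and \<omega> \<theta> P \<epsilon> C N :: real
    and g :: "'m \<Rightarrow> 'a" and z :: "'m \<Rightarrow> real \<Rightarrow> 'a"
  assumes N: "N = real CARD('m)"
    and grad: "\<And>x. GDERIV h x :> D x"
    and mono: "\<And>x. x \<bullet> D x \<ge> \<omega> * (norm x)\<^sup>2"
    and lip: "\<And>x y. norm (D x - D y) \<le> \<theta> * norm (x - y)"
    and D0: "D 0 = 0"
    and pos: "\<omega> > 0" "\<theta> > 0" "P > 0" "C > 0"
    and \<epsilon>: "0 < \<epsilon>" "\<epsilon> \<le> 1 / 4"
    and \<rho>: "\<rho> = \<epsilon> * P" and c: "c = \<epsilon> * \<rho>"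
    and norm_\<xi>: "\<And>i. norm (\<xi> i) \<le> C" and norm_g: "\<And>i. norm (g i) \<le> C"
    and sum_g: "(\<Sum>i\<in>UNIV. g i) = 0"
    and dual: "\<And>x. (\<Sum>i\<in>UNIV. (\<xi> i \<bullet> x) *\<^sub>R g i) = x"
    and dy: "\<And>t i. t \<ge> 0 \<Longrightarrow> (y i has_vector_derivative
        - (y i t - (N / \<rho> * h (p i t)) *\<^sub>R g i) - (z i t - mean (\<lambda>j. z j t))) (at t within {0..})"
    and dz: "\<And>t i. t \<ge> 0 \<Longrightarrow> (z i has_vector_derivative
        (2 / 9) *\<^sub>R (y i t - mean (\<lambda>j. y j t))) (at t within {0..})"
begin

text \<open>\<open>K1\<close> measures how fast the inputs change and \<open>K2\<close> how far
  their mean is from the gradient, both in units of \<open>\<epsilon> * B\<close>. In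
  \<open>K1\<close>, the 9 bounds velocities in units of \<open>c\<close> and \<open>C + 9\<close>
  bounds positions in units of \<open>B\<close>; in \<open>K2\<close>, the 8 stems from the
  formation error and the square from the Taylor remainder.\<close>

definition "K1 = 9 * N * \<theta> * C * (C + 9)"
definition "K2 = N * C * \<theta> * (8 + (C + 8)\<^sup>2)"

lemma N_pos: "N > 0"
  by (simp add: N)

lemma K_pos: "K1 > 0" "K2 > 0"
  using pos N_pos by (auto simp: K1_def K2_def intro!: mult_pos_pos add_pos_nonneg)

lemma \<rho>_pos: "\<rho> > 0" and \<rho>_le: "\<rho> \<le> P" and c_le: "c \<le> \<rho>"
proof -
  show "\<rho> > 0" using \<epsilon> pos \<rho> by simp
  then show "c \<le> \<rho>" "\<rho> \<le> P" using \<epsilon> pos by (auto simp: c \<rho> mult_le_cancel_right1)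
qed

text \<open>A smooth positive stand-in for \<open>norm (center t)\<close>: it grows at relative rate at most \<open>\<epsilon>\<^sup>2\<close>, so the
  filters of the estimator can be compared with multiples of it.\<close>
definition "B t = sqrt (P\<^sup>2 + (norm (center t))\<^sup>2)" for t

lemma B_ge: "P \<le> B t" "norm (center t) \<le> B t"
  by (auto simp: B_def intro!: real_le_rsqrt)

lemma B_pos: "B t > 0"
  using B_ge(1)[of t] pos by linarith

definition "B' t = center t \<bullet> mean (\<lambda>i. - c *\<^sub>R saturate 1 (y i t)) / B t" for t

lemma d_B: assumes "t \<ge> 0" shows "(B has_real_derivative B' t) (at t within {0..})"
proof -
  have "((\<lambda>t. P\<^sup>2 + (norm (center t))\<^sup>2) has_real_derivative
      2 * (center t \<bullet> mean (\<lambda>i. - c *\<^sub>R saturate 1 (y i t)))) (at t within {0..})"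
    using DERIV_add[OF DERIV_const has_real_derivative_norm_power2[OF d_center[OF assms]]]
    by simp
  moreover have "P\<^sup>2 + (norm (center t))\<^sup>2 > 0" using pos by (simp add: add_pos_nonneg)
  ultimately have "((\<lambda>t. sqrt (P\<^sup>2 + (norm (center t))\<^sup>2)) has_real_derivative
      (inverse (sqrt (P\<^sup>2 + (norm (center t))\<^sup>2)) / 2) * (2 * (center t \<bullet> mean (\<lambda>i. - c *\<^sub>R saturate 1 (y i t)))))
      (at t within {0..})"
    by (intro DERIV_chain2[OF DERIV_real_sqrt])
  moreover have "(inverse (sqrt (P\<^sup>2 + (norm (center t))\<^sup>2)) / 2)
      * (2 * (center t \<bullet> mean (\<lambda>i. - c *\<^sub>R saturate 1 (y i t)))) = B' t"
    unfolding B'_def B_def by (simp only: divide_inverse) simp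
  ultimately show ?thesis unfolding B_def[abs_def] by (simp only:)
qed

text \<open>The speed bound gives \<open>c = \<epsilon> * \<epsilon> * P\<close>, at most
  \<open>B t / 16\<close> because \<epsilon> is at most \<open>1 / 4\<close>. This is below
  \<open>l / 4 * B t\<close> down to \<open>l = 1 / 3\<close>, the slowest filter rate that
  occurs.\<close>

lemma abs_B'_le:
  assumes "t \<ge> 0" and "l \<ge> 1 / 3"
  shows "\<bar>B' t\<bar> \<le> l / 4 * B t"
proof -
  have "\<bar>center t \<bullet> mean (\<lambda>i. - c *\<^sub>R saturate 1 (y i t))\<bar> \<le> norm (center t) * norm (mean (\<lambda>i. - c *\<^sub>R saturate 1 (y i t)))"
    by (rule Cauchy_Schwarz_ineq2)
  also have "\<dots> \<le> B t * c"
    using B_ge(2) norm_mean_s_le[OF assms(1)] B_pos[of t] by (intro mult_mono) auto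
  finally have "\<bar>B' t\<bar> \<le> c" using B_pos[of t] by (simp add: B'_def abs_divide divide_le_eq mult.commute)
  also have "c \<le> (1/4 * (1/4)) * B t"
    unfolding c \<rho> mult.assoc[symmetric] using \<epsilon> B_ge(1)[of t] pos by (intro mult_mono) auto
  also have "\<dots> \<le> l / 4 * B t" using assms B_pos[of t] by (intro mult_right_mono) auto
  finally show ?thesis .
qed

text \<open>The forcing of \<open>y i\<close>: the offset supplies one factor \<rho> and the inverse
  offset matrix \<open>1 / \<rho>^2\<close>, which leaves \<open>N / \<rho>\<close>.\<close>

definition "u i t = (N / \<rho> * h (p i t)) *\<^sub>R g i" for i t
definition "u' i t = (N / \<rho> * (D (p i t) \<bullet> (- c *\<^sub>R saturate 1 (y i t) - err i t))) *\<^sub>R g i" for i t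

lemma d_u:
  assumes "t \<ge> 0"
  shows "(u i has_vector_derivative u' i t) (at t within {0..})"
  unfolding u_def[abs_def] u'_def
  by (rule has_vector_derivative_eq_rhs[OF has_vector_derivative_scaleR[OF
      DERIV_cmult[OF GDERIV_chain_within[OF grad d_p[OF assms]]] has_vector_derivative_const]]) simp

lemma d_mean_u: "t \<ge> 0 \<Longrightarrow>
    ((\<lambda>t. mean (\<lambda>i. u i t)) has_vector_derivative mean (\<lambda>i. u' i t)) (at t within {0..})"
  by (rule has_vector_derivative_mean) (rule d_u)

lemma eventually_err: "eventually (\<lambda>t. t \<ge> 0 \<and> (\<forall>i. norm (err i t) \<le> 8 * c)) at_top"
  by (intro eventually_conj eventually_ge_at_top eventually_all_finite eventually_norm_err_le)

lemma norm_D_le: "norm (D x) \<le> \<theta> * norm x"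
  using lip[of x 0] D0 by simp

lemma norm_offset_le:
  assumes "norm (err i t) \<le> 8 * c"
  shows "norm (p i t - center t) \<le> \<rho> * (C + 8)"
proof -
  have "norm (p i t - center t) \<le> norm (\<rho> *\<^sub>R \<xi> i) + norm (err i t)"
    unfolding err_def by (metis diff_add_cancel norm_triangle_ineq add.commute)
  also have "\<dots> \<le> \<rho> * C + 8 * \<rho>"
    using assms c_le \<rho>_pos norm_\<xi>[of i] by (intro add_mono) auto
  finally show ?thesis by (simp add: algebra_simps)
qed

text \<open>The factor \<open>1 / \<rho>\<close> is compensated by the velocity, eventually at most
  \<open>9 * c = 9 * \<epsilon> * \<rho>\<close>. The gradient grows linearly with the position,
  whence the factor \<open>B t\<close>.\<close>

lemma eventually_norm_u'_le: "eventually (\<lambda>t. \<forall>i. norm (u' i t) \<le> K1 * \<epsilon> * B t) at_top"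
  using eventually_err
proof eventually_elim
  case (elim t)
  show ?case
  proof
    fix i
    have err: "norm (err i t) \<le> 8 * c" and t: "t \<ge> 0" using elim by auto
    have "norm (p i t) \<le> norm (center t) + norm (p i t - center t)"
      by (rule norm_triangle_sub)
    also have "\<dots> \<le> B t + B t * (C + 8)"
      using norm_offset_le[OF err] \<rho>_le B_ge[of t] pos
      by (intro add_mono order_trans[OF _ mult_right_mono[of \<rho> "B t"]]) auto
    finally have "norm (p i t) \<le> (C + 9) * B t" by (simp add: algebra_simps)
    then have D: "norm (D (p i t)) \<le> \<theta> * ((C + 9) * B t)"
      using norm_D_le[of "p i t"] pos(2) mult_left_mono[of "norm (p i t)" "(C + 9) * B t" \<theta>] by linarith
    have v: "norm (- c *\<^sub>R saturate 1 (y i t) - err i t) \<le> 9 * c"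
      using norm_triangle_ineq4[of "- c *\<^sub>R saturate 1 (y i t)" "err i t"] norm_s_le[OF t, of i] err by linarith
    have "\<bar>D (p i t) \<bullet> (- c *\<^sub>R saturate 1 (y i t) - err i t)\<bar> \<le> \<theta> * ((C + 9) * B t) * (9 * c)"
      by (rule order_trans[OF Cauchy_Schwarz_ineq2]) (use D v pos B_pos[of t] in \<open>auto intro!: mult_mono\<close>)
    then have "norm (u' i t) \<le> N / \<rho> * (\<theta> * ((C + 9) * B t) * (9 * c)) * C"
      unfolding u'_def norm_scaleR abs_mult using \<rho>_pos norm_g[of i] pos c_pos B_pos[of t]
      by (intro mult_mono) (auto simp: N)
    also have "\<dots> = K1 * \<epsilon> * B t" using \<rho>_pos by (simp add: K1_def c)
    finally show "norm (u' i t) \<le> K1 * \<epsilon> * B t" .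
  qed
qed

text \<open>Expand \<open>h\<close> around the center. The constant term is killed by
  \<open>sum_g\<close> and the linear term in \<xi> is reproduced exactly by \<open>dual\<close>,
  leaving the formation error and the Taylor remainder.\<close>

lemma mean_u_eq:
  "mean (\<lambda>i. u i t) - D (center t)
    = (\<Sum>i\<in>UNIV. ((D (center t) \<bullet> err i t
        + (h (p i t) - h (center t) - D (center t) \<bullet> (p i t - center t))) / \<rho>) *\<^sub>R g i)"
proof -
  have h: "h (p i t) / \<rho> = h (center t) / \<rho> + \<xi> i \<bullet> D (center t) + (D (center t) \<bullet> err i t
        + (h (p i t) - h (center t) - D (center t) \<bullet> (p i t - center t))) / \<rho>" for i
    using \<rho>_pos by (simp add: err_def field_simps inner_diff_right inner_add_right inner_commute)
  have "mean (\<lambda>i. u i t) = (\<Sum>i\<in>UNIV. (h (p i t) / \<rho>) *\<^sub>R g i)"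
    using N_pos by (simp add: mean_def u_def scaleR_sum_right flip: N)
  also have "\<dots> = (h (center t) / \<rho>) *\<^sub>R (\<Sum>i\<in>UNIV. g i) + (\<Sum>i\<in>UNIV. (\<xi> i \<bullet> D (center t)) *\<^sub>R g i)
     + (\<Sum>i\<in>UNIV. ((D (center t) \<bullet> err i t
        + (h (p i t) - h (center t) - D (center t) \<bullet> (p i t - center t))) / \<rho>) *\<^sub>R g i)"
    unfolding scaleR_sum_right by (subst h) (simp only: scaleR_left_distrib sum.distrib)
  finally show ?thesis using dual sum_g by simp
qed

text \<open>The formation error enters with \<open>8 * c / \<rho> = 8 * \<epsilon>\<close> times a
  gradient of size \<open>\<theta> * B t\<close>; the remainder is of order
  \<open>\<rho>^2 / \<rho> = \<epsilon> * P\<close>, and \<open>P\<close> is at most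
  \<open>B t\<close>.\<close>

lemma eventually_mean_u: "eventually (\<lambda>t. norm (mean (\<lambda>i. u i t) - D (center t)) \<le> K2 * \<epsilon> * B t) at_top"
  using eventually_err
proof eventually_elim
  case (elim t)
  have "norm (mean (\<lambda>i. u i t) - D (center t)) \<le> N * ((\<theta> * B t * (8 * c) + \<theta> * (\<rho> * (C + 8))\<^sup>2) / \<rho> * C)"
    unfolding mean_u_eq
  proof (unfold N, rule sum_norm_bound)
    fix i
    have err: "norm (err i t) \<le> 8 * c" using elim by auto
    have "norm (D (center t)) \<le> \<theta> * B t"
      using norm_D_le[of "center t"] pos(2) mult_left_mono[OF B_ge(2)[of t], of \<theta>] by linarith
    then have 1: "\<bar>D (center t) \<bullet> err i t\<bar> \<le> \<theta> * B t * (8 * c)"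
      by (intro order_trans[OF Cauchy_Schwarz_ineq2] mult_mono) (use err pos B_pos[of t] in auto)
    have "\<bar>h (p i t) - h (center t) - D (center t) \<bullet> (p i t - center t)\<bar>
        \<le> \<theta> * (norm (p i t - center t))\<^sup>2"
      using lipschitz_gradient_remainder_le[OF grad lip pos(2), of "center t" "p i t - center t"] by simp
    also have "\<dots> \<le> \<theta> * (\<rho> * (C + 8))\<^sup>2"
      using norm_offset_le[OF err] pos by (intro mult_left_mono power_mono) auto
    finally have 2: "\<bar>D (center t) \<bullet> err i t
        + (h (p i t) - h (center t) - D (center t) \<bullet> (p i t - center t))\<bar>
      \<le> \<theta> * B t * (8 * c) + \<theta> * (\<rho> * (C + 8))\<^sup>2"
      using 1 by linarith
    show "norm (((D (center t) \<bullet> err i t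
        + (h (p i t) - h (center t) - D (center t) \<bullet> (p i t - center t))) / \<rho>) *\<^sub>R g i)
       \<le> (\<theta> * B t * (8 * c) + \<theta> * (\<rho> * (C + 8))\<^sup>2) / \<rho> * C"
      unfolding norm_scaleR real_norm_def abs_divide
      using 2 \<rho>_pos norm_g[of i] by (intro mult_mono) (auto intro: divide_right_mono)
  qed
  also have "\<dots> = N * C * \<theta> * (8 * \<epsilon> * B t + (C + 8)\<^sup>2 * \<epsilon> * P)"
    using \<rho>_pos pos \<epsilon> by (simp add: c \<rho> field_simps power2_eq_square)
  also have "\<dots> \<le> N * C * \<theta> * (8 * \<epsilon> * B t + (C + 8)\<^sup>2 * \<epsilon> * B t)"
    using pos \<epsilon> B_ge(1)[of t] by (intro mult_left_mono add_left_mono) (auto simp: N)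
  also have "\<dots> = K2 * \<epsilon> * B t" by (simp add: K2_def algebra_simps)
  finally show ?case .
qed

section \<open>Estimator dynamics: disagreement and tracking error\<close>

definition "\<eta> i t = y i t - mean (\<lambda>j. y j t)" for i t
text \<open>The part of the input disagreement that the integrator state has not yet compensated.
  With \<nu> in place of \<open>z\<close>, the linear system is driven by \<open>u'\<close>, which
  is of order \<epsilon> relative to \<open>B\<close>, rather than by \<open>u\<close>, which is
  not.\<close>

definition "\<nu> i t = (u i t - mean (\<lambda>j. u j t)) - (z i t - mean (\<lambda>j. z j t))" for i t

lemma d_mean_y:
  assumes "t \<ge> 0"
  shows "((\<lambda>t. mean (\<lambda>i. y i t)) has_vector_derivative mean (\<lambda>i. u i t) - mean (\<lambda>i. y i t)) (at t within {0..})"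
  using has_vector_derivative_mean[of y, OF dy[OF assms]]
  by (simp add: mean_diff mean_uminus mean_const u_def del: minus_diff_eq) simp

lemma d_mean_z:
  assumes "t \<ge> 0"
  shows "((\<lambda>t. mean (\<lambda>i. z i t)) has_vector_derivative 0) (at t within {0..})"
  using has_vector_derivative_mean[of z, OF dz[OF assms]]
  by (simp only: mean_diff mean_scaleR mean_const) simp

lemma d_\<eta>:
  assumes "t \<ge> 0"
  shows "(\<eta> i has_vector_derivative \<nu> i t - \<eta> i t) (at t within {0..})"
proof -
  have "(\<eta> i has_vector_derivative
    - (y i t - u i t) - (z i t - mean (\<lambda>j. z j t)) - (mean (\<lambda>i. u i t) - mean (\<lambda>i. y i t))) (at t within {0..})"
    unfolding \<eta>_def[abs_def] u_def[of i]
    by (intro has_vector_derivative_diff dy d_mean_y assms)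
  then show ?thesis by (simp add: \<nu>_def \<eta>_def algebra_simps)
qed

lemma d_\<nu>:
  assumes "t \<ge> 0"
  shows "(\<nu> i has_vector_derivative (u' i t - mean (\<lambda>j. u' j t)) - (2 / 9) *\<^sub>R \<eta> i t) (at t within {0..})"
proof -
  have "(\<nu> i has_vector_derivative (u' i t - mean (\<lambda>j. u' j t)) - ((2 / 9) *\<^sub>R \<eta> i t - 0)) (at t within {0..})"
    unfolding \<nu>_def[abs_def] \<eta>_def[of i]
    by (intro has_vector_derivative_diff d_u d_mean_u dz d_mean_z assms)
  then show ?thesis by simp
qed

text \<open>The choice \<open>\<mu> = 2/9\<close> gives the disagreement dynamics of \<open>(\<eta>, \<nu>)\<close> the eigenvalues \<open>-1/3\<close> and
  \<open>-2/3\<close>; \<open>\<nu> - l \<eta>\<close> are the corresponding left eigenvectors.\<close>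

lemma eventually_mode:
  assumes l: "l = 1 / 3 \<or> l = 2 / 3"
  shows "eventually (\<lambda>t. norm (\<nu> i t - l *\<^sub>R \<eta> i t) \<le> 24 * K1 * \<epsilon> * B t) at_top"
proof -
  have "eventually (\<lambda>t. norm (\<nu> i t - l *\<^sub>R \<eta> i t) \<le> 4 * (2 * K1 * \<epsilon>) / l * B t) at_top"
  proof (rule stable_filter_eventually_le[where B = B and B' = B'])
    fix t :: real assume t: "t \<ge> 0"
    have "((\<lambda>t. \<nu> i t - l *\<^sub>R \<eta> i t) has_vector_derivative
        (u' i t - mean (\<lambda>j. u' j t)) - (2 / 9) *\<^sub>R \<eta> i t - l *\<^sub>R (\<nu> i t - \<eta> i t)) (at t within {0..})"
      by (intro has_vector_derivative_diff d_\<nu> t bounded_linear.has_vector_derivative[OF bounded_linear_scaleR_right] d_\<eta>)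
    moreover have "(u' i t - mean (\<lambda>j. u' j t)) - (2 / 9) *\<^sub>R \<eta> i t - l *\<^sub>R (\<nu> i t - \<eta> i t)
        = (u' i t - mean (\<lambda>j. u' j t)) - l *\<^sub>R (\<nu> i t - l *\<^sub>R \<eta> i t) + (l - l * l - 2 / 9) *\<^sub>R \<eta> i t"
      by (simp add: algebra_simps)
    moreover have "l - l * l - 2 / 9 = 0" using l by (elim disjE; hypsubst; simp)
    ultimately show "((\<lambda>t. \<nu> i t - l *\<^sub>R \<eta> i t) has_vector_derivative
        (u' i t - mean (\<lambda>j. u' j t)) - l *\<^sub>R (\<nu> i t - l *\<^sub>R \<eta> i t)) (at t within {0..})" by simp
    show "\<bar>B' t\<bar> \<le> l / 4 * B t" using abs_B'_le[OF t] l by auto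
  next
    show "eventually (\<lambda>t. norm (u' i t - mean (\<lambda>j. u' j t)) \<le> 2 * K1 * \<epsilon> * B t) at_top"
      using eventually_norm_u'_le
    proof eventually_elim
      case (elim t)
      then have "norm (u' i t) \<le> K1 * \<epsilon> * B t" "norm (mean (\<lambda>j. u' j t)) \<le> K1 * \<epsilon> * B t"
        by (auto intro: norm_mean_le)
      then show ?case using norm_triangle_ineq4[of "u' i t" "mean (\<lambda>j. u' j t)"] by linarith
    qed
  qed (use d_B B_pos l K_pos \<epsilon> in auto)
  then show ?thesis
  proof eventually_elim
    case (elim t)
    \<comment> \<open>The slower rate \<open>1 / 3\<close> is the worse case and turns
      \<open>8 / l\<close> into 24, so that one constant serves both modes.\<close>
    have "4 * (2 * K1 * \<epsilon>) / l * B t \<le> 24 * K1 * \<epsilon> * B t"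
    proof (rule mult_right_mono)
      have "1 / l \<le> 3" using l by (elim disjE; hypsubst; simp)
      then have "8 * K1 * \<epsilon> * (1 / l) \<le> 8 * K1 * \<epsilon> * 3"
        using K_pos \<epsilon> by (intro mult_left_mono) auto
      then show "4 * (2 * K1 * \<epsilon>) / l \<le> 24 * K1 * \<epsilon>" by simp
    qed (use B_pos[of t] in simp)
    with elim show ?case by linarith
  qed
qed

text \<open>The two modes differ by \<open>\<eta> / 3\<close>, which gives
  \<open>3 * (24 + 24) = 144\<close>.\<close>

lemma eventually_\<eta>: "eventually (\<lambda>t. norm (\<eta> i t) \<le> 144 * K1 * \<epsilon> * B t) at_top"
  using eventually_mode[of "1 / 3" i, OF disjI1[OF refl]] eventually_mode[of "2 / 3" i, OF disjI2[OF refl]]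
proof eventually_elim
  case (elim t)
  have "\<eta> i t = 3 *\<^sub>R ((\<nu> i t - (1 / 3) *\<^sub>R \<eta> i t) - (\<nu> i t - (2 / 3) *\<^sub>R \<eta> i t))"
    by (simp add: scaleR_diff_right flip: scaleR_left_diff_distrib)
  then have "norm (\<eta> i t) = 3 * norm ((\<nu> i t - (1 / 3) *\<^sub>R \<eta> i t) - (\<nu> i t - (2 / 3) *\<^sub>R \<eta> i t))"
    by (metis norm_scaleR abs_numeral)
  with elim show ?case
    using norm_triangle_ineq4[of "\<nu> i t - (1 / 3) *\<^sub>R \<eta> i t" "\<nu> i t - (2 / 3) *\<^sub>R \<eta> i t"] by linarith
qed

text \<open>Averaging cancels the \<open>z\<close> terms, so the mean of \<open>y\<close> follows
  the mean of \<open>u\<close> as a filter of rate 1, and the tracking error is driven by the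
  derivative of the latter.\<close>

lemma eventually_mean_y:
  "eventually (\<lambda>t. norm (mean (\<lambda>i. y i t) - mean (\<lambda>i. u i t)) \<le> 4 * K1 * \<epsilon> * B t) at_top"
proof -
  have "eventually (\<lambda>t. norm (mean (\<lambda>i. y i t) - mean (\<lambda>i. u i t)) \<le> 4 * (K1 * \<epsilon>) / 1 * B t) at_top"
  proof (rule stable_filter_eventually_le[where B = B and B' = B'])
    fix t :: real assume t: "t \<ge> 0"
    have "((\<lambda>t. mean (\<lambda>i. y i t) - mean (\<lambda>i. u i t)) has_vector_derivative
        (mean (\<lambda>i. u i t) - mean (\<lambda>i. y i t)) - mean (\<lambda>i. u' i t)) (at t within {0..})"
      by (intro has_vector_derivative_diff d_mean_y d_mean_u t)
    then show "((\<lambda>t. mean (\<lambda>i. y i t) - mean (\<lambda>i. u i t)) has_vector_derivative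
        - mean (\<lambda>i. u' i t) - 1 *\<^sub>R (mean (\<lambda>i. y i t) - mean (\<lambda>i. u i t))) (at t within {0..})"
      by (simp add: algebra_simps)
    show "\<bar>B' t\<bar> \<le> 1 / 4 * B t" by (rule abs_B'_le[OF t]) simp
  next
    show "eventually (\<lambda>t. norm (- mean (\<lambda>i. u' i t)) \<le> K1 * \<epsilon> * B t) at_top"
      using eventually_norm_u'_le by eventually_elim (auto intro: norm_mean_le)
  qed (use d_B B_pos K_pos \<epsilon> in auto)
  then show ?thesis by (simp add: mult.assoc)
qed

lemma eventually_y: "eventually (\<lambda>t. norm (y i t - D (center t)) \<le> (148 * K1 + K2) * \<epsilon> * B t) at_top"
  using eventually_\<eta>[of i] eventually_mean_y eventually_mean_u
proof eventually_elim
  case (elim t)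
  have "y i t - D (center t) = \<eta> i t + (mean (\<lambda>i. y i t) - mean (\<lambda>i. u i t)) + (mean (\<lambda>i. u i t) - D (center t))"
    by (simp add: \<eta>_def)
  then have "norm (y i t - D (center t)) \<le> norm (\<eta> i t) + norm (mean (\<lambda>i. y i t) - mean (\<lambda>i. u i t))
      + norm (mean (\<lambda>i. u i t) - D (center t))"
    by (metis norm_triangle_le norm_triangle_ineq add_mono order_refl)
  also have "\<dots> \<le> (148 * K1 + K2) * \<epsilon> * B t" using elim by (simp add: algebra_simps)
  finally show ?case .
qed


text \<open>Where \<open>r = norm (center t)\<close> is at least \<open>P\<close>,
  \<open>B t\<close> is at most \<open>2 * r\<close>. By \<open>small\<close> each
  \<open>y i\<close> then deviates from the gradient by at most \<open>\<omega> / 2 * r\<close>, so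
  half of the strong monotonicity survives. Saturation divides by at most \<open>1 + k * r\<close>,
  which still leaves a uniform decrease.\<close>

lemma eventually_center_le:
  assumes small: "4 * (148 * K1 + K2) * \<epsilon> \<le> \<omega>"
  shows "eventually (\<lambda>t. norm (center t) \<le> P) at_top"
proof -
  \<comment> \<open>\<open>k * r\<close> bounds \<open>norm (y i t)\<close>, and \<open>m\<close> is
    the value of \<open>\<omega> / 2 * r^2 / (1 + k * r)\<close> at \<open>r = P\<close>. This
    quotient increases with \<open>r\<close>, so \<open>m\<close> is a lower bound outside the
    ball.\<close>
  define k where "k = \<theta> + \<omega>"
  define m where "m = \<omega> / 2 * P\<^sup>2 / (1 + k * P)"
  have k: "k > 0" using pos by (simp add: k_def)
  have m: "m > 0" using pos k by (simp add: m_def add_pos_pos)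
  have "eventually (\<lambda>t. \<forall>i. norm (y i t - D (center t)) \<le> (148 * K1 + K2) * \<epsilon> * B t) at_top"
    by (intro eventually_all_finite eventually_y)
  then obtain T0 where T0: "\<And>t i. t \<ge> T0 \<Longrightarrow> norm (y i t - D (center t)) \<le> (148 * K1 + K2) * \<epsilon> * B t"
    by (auto simp: eventually_at_top_linorder)
  define T where "T = max 0 T0"
  have "eventually (\<lambda>t. (norm (center t))\<^sup>2 \<le> P\<^sup>2) at_top"
  proof (rule eventually_sublevel)
    fix t assume "t \<ge> T"
    then have t: "t \<ge> 0" "t \<ge> T0" by (auto simp: T_def)
    show "((\<lambda>t. (norm (center t))\<^sup>2) has_real_derivative
        2 * (center t \<bullet> mean (\<lambda>i. - c *\<^sub>R saturate 1 (y i t)))) (at t within {T..})"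
      by (rule DERIV_subset[OF has_real_derivative_norm_power2[OF d_center[OF t(1)]]]) (simp add: T_def)
    assume "(norm (center t))\<^sup>2 \<ge> P\<^sup>2"
    define r where "r = norm (center t)"
    have r: "r \<ge> P" "r > 0"
      using \<open>(norm (center t))\<^sup>2 \<ge> P\<^sup>2\<close> pos power2_le_imp_le[of P r] by (auto simp: r_def intro: less_le_trans)
    have "B t \<le> sqrt ((2 * r)\<^sup>2)"
      unfolding B_def r_def[symmetric]
    proof (rule real_sqrt_le_mono)
      have "P\<^sup>2 \<le> r\<^sup>2" using r pos by (intro power_mono) auto
      moreover have "(2 * r)\<^sup>2 = 4 * r\<^sup>2" by (simp add: power_mult_distrib)
      ultimately show "P\<^sup>2 + r\<^sup>2 \<le> (2 * r)\<^sup>2" using zero_le_power2[of r] by linarith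
    qed
    then have Br: "B t \<le> 2 * r" using r by (simp only: real_sqrt_abs)
    have dev: "norm (y i t - D (center t)) \<le> \<omega> / 2 * r" for i
    proof -
      have "(148 * K1 + K2) * \<epsilon> * B t \<le> (148 * K1 + K2) * \<epsilon> * (2 * r)"
        using Br K_pos \<epsilon> by (intro mult_left_mono) auto
      also have "\<dots> = (4 * (148 * K1 + K2) * \<epsilon>) / 2 * r" by simp
      also have "\<dots> \<le> \<omega> / 2 * r" using small r by (intro mult_right_mono) auto
      finally show ?thesis using T0[OF t(2), of i] by linarith
    qed
    have "m \<le> center t \<bullet> saturate 1 (y i t)" for i
    proof -
      define n where "n = max 1 (norm (y i t))"
      have "norm (y i t) \<le> norm (D (center t)) + norm (y i t - D (center t))"
        by (rule norm_triangle_sub)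
      also have "\<dots> \<le> k * r"
        using norm_D_le[of "center t"] dev[of i] mult_pos_pos[OF pos(1) r(2)] by (simp add: k_def r_def algebra_simps)
      finally have n: "n \<le> 1 + k * r" "n > 0" using k r by (auto simp: n_def)
      have "\<bar>center t \<bullet> (y i t - D (center t))\<bar> \<le> r * (\<omega> / 2 * r)"
        by (rule order_trans[OF Cauchy_Schwarz_ineq2]) (use dev[of i] r in \<open>auto simp: r_def intro!: mult_mono\<close>)
      moreover have "\<omega> * r\<^sup>2 \<le> center t \<bullet> D (center t)" using mono by (simp add: r_def)
      moreover have "r * (\<omega> / 2 * r) = \<omega> / 2 * r\<^sup>2" by (simp add: power2_eq_square)
      ultimately have ip: "\<omega> / 2 * r\<^sup>2 \<le> center t \<bullet> y i t"
        unfolding inner_diff_right by linarith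
      have "P\<^sup>2 * (1 + k * r) \<le> r\<^sup>2 * (1 + k * P)"
      proof -
        have "P * P \<le> r * r" using r pos by (intro mult_mono) auto
        moreover have "(k * P * r) * P \<le> (k * P * r) * r" using r pos k by (intro mult_left_mono) auto
        ultimately show ?thesis by (simp add: power2_eq_square algebra_simps)
      qed
      then have "P\<^sup>2 / (1 + k * P) \<le> r\<^sup>2 / (1 + k * r)"
        using k pos r by (simp add: field_simps add_pos_pos)
      then have "\<omega> / 2 * (P\<^sup>2 / (1 + k * P)) \<le> \<omega> / 2 * (r\<^sup>2 / (1 + k * r))"
        using pos by (intro mult_left_mono) auto
      then have "m \<le> \<omega> / 2 * r\<^sup>2 / (1 + k * r)" by (simp add: m_def)
      also have "\<dots> \<le> \<omega> / 2 * r\<^sup>2 / n" using n pos by (intro divide_left_mono) (auto simp: add_pos_pos k r)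
      also have "\<dots> \<le> (center t \<bullet> y i t) / n" using ip n by (intro divide_right_mono) auto
      finally show ?thesis by (simp add: saturate_def n_def)
    qed
    then have "m \<le> center t \<bullet> mean (\<lambda>i. saturate 1 (y i t))" by (rule inner_mean_ge)
    then have "2 * c * m \<le> 2 * c * (center t \<bullet> mean (\<lambda>i. saturate 1 (y i t)))"
      using c_pos by (intro mult_left_mono) auto
    then show "2 * (center t \<bullet> mean (\<lambda>i. - c *\<^sub>R saturate 1 (y i t))) \<le> - (2 * c * m)"
      by (simp only: mean_scaleR inner_scaleR_right)
  qed (use m c_pos in simp)
  then show ?thesis
    by eventually_elim (rule power2_le_imp_le, use pos in auto)
qed

text \<open>With the center eventually in the ball, \<open>B\<close> is eventually at most
  \<open>2 * P\<close> and all relative bounds become absolute; continuity on a compact interval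
  covers the transient.\<close>

lemma states_bounded:
  assumes small: "4 * (148 * K1 + K2) * \<epsilon> \<le> \<omega>"
  shows "bounded (p i ` {0..})" "bounded (y i ` {0..})" "bounded (z i ` {0..})"
proof -
  have "continuous_on {0..} f" if "\<And>t. t \<ge> 0 \<Longrightarrow> (f has_vector_derivative f' t) (at t within {0..})"
    for f f' :: "real \<Rightarrow> 'a"
    unfolding continuous_on_eq_continuous_within using that by (auto intro: has_vector_derivative_continuous)
  note cont = this[OF d_p] this[OF dy] this[OF d_\<nu>]
  have evB: "eventually (\<lambda>t. B t \<le> 2 * P) at_top"
    using eventually_center_le[OF small]
  proof eventually_elim
    case (elim t)
    then have "(norm (center t))\<^sup>2 \<le> P\<^sup>2" by (intro power_mono) auto
    moreover have "(2 * P)\<^sup>2 = 4 * P\<^sup>2" by (simp add: power_mult_distrib)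
    ultimately have "P\<^sup>2 + (norm (center t))\<^sup>2 \<le> (2 * P)\<^sup>2"
      using zero_le_power2[of P] by linarith
    then have "B t \<le> sqrt ((2 * P)\<^sup>2)" unfolding B_def by (rule real_sqrt_le_mono)
    then show ?case using pos by (simp only: real_sqrt_abs)
  qed
  have p: "bounded (p i ` {0..})" for i
  proof (rule bounded_image_if_eventually_norm_le[OF cont(1)])
    show "eventually (\<lambda>t. norm (p i t) \<le> P + \<rho> * (C + 8)) at_top"
      using eventually_center_le[OF small] eventually_err
    proof eventually_elim
      case (elim t)
      then show ?case
        using norm_offset_le[of i t] norm_triangle_sub[of "p i t" "center t"] by force
    qed
  qed
  then show "bounded (p i ` {0..})" .
  show "bounded (y i ` {0..})"
  proof (rule bounded_image_if_eventually_norm_le[OF cont(2)])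
    show "eventually (\<lambda>t. norm (y i t) \<le> \<theta> * P + (148 * K1 + K2) * \<epsilon> * (2 * P)) at_top"
      using eventually_y[of i] evB eventually_center_le[OF small]
    proof eventually_elim
      case (elim t)
      have "norm (D (center t)) \<le> \<theta> * P"
        using norm_D_le[of "center t"] mult_left_mono[OF elim(3), of \<theta>] pos by linarith
      moreover have "(148 * K1 + K2) * \<epsilon> * B t \<le> (148 * K1 + K2) * \<epsilon> * (2 * P)"
        using elim K_pos \<epsilon> by (intro mult_left_mono) auto
      ultimately show ?case
        using elim(1) norm_triangle_sub[of "y i t" "D (center t)"] by linarith
    qed
  qed
  have u: "bounded (u i ` {0..})" for i
  proof -
    obtain r where r: "\<And>t. t \<ge> 0 \<Longrightarrow> norm (p i t) \<le> r"
      using p[of i] by (auto simp: bounded_iff)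
    have "norm (u i t) \<le> N / \<rho> * (\<bar>h 0\<bar> + \<theta> * r\<^sup>2) * C" if t: "t \<ge> 0" for t
    proof -
      have "\<theta> * (norm (p i t))\<^sup>2 \<le> \<theta> * r\<^sup>2"
        using r[OF t] pos by (intro mult_left_mono power_mono) auto
      then have "\<bar>h (p i t)\<bar> \<le> \<bar>h 0\<bar> + \<theta> * r\<^sup>2"
        using lipschitz_gradient_remainder_le[OF grad lip pos(2), of 0 "p i t"] D0 by simp
      then show ?thesis
        unfolding u_def norm_scaleR real_norm_def abs_mult abs_divide
        using \<rho>_pos N_pos norm_g[of i] pos by (intro mult_mono) auto
    qed
    then show ?thesis by (intro boundedI) auto
  qed
  have "bounded (\<nu> i ` {0..})"
  proof (rule bounded_image_if_eventually_norm_le[OF cont(3)])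
    show "eventually (\<lambda>t. norm (\<nu> i t) \<le> 24 * K1 * \<epsilon> * (2 * P) + 144 * K1 * \<epsilon> * (2 * P)) at_top"
      using eventually_mode[of "1 / 3" i, OF disjI1[OF refl]] eventually_\<eta>[of i] evB
    proof eventually_elim
      case (elim t)
      have 1: "24 * K1 * \<epsilon> * B t \<le> 24 * K1 * \<epsilon> * (2 * P)" "144 * K1 * \<epsilon> * B t \<le> 144 * K1 * \<epsilon> * (2 * P)"
        using elim K_pos \<epsilon> by (auto intro!: mult_left_mono)
      have "norm (\<nu> i t) \<le> norm ((1 / 3) *\<^sub>R \<eta> i t) + norm (\<nu> i t - (1 / 3) *\<^sub>R \<eta> i t)"
        by (rule norm_triangle_sub)
      moreover have "norm ((1 / 3) *\<^sub>R \<eta> i t) \<le> norm (\<eta> i t)" by simp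
      ultimately show ?case using elim 1 by linarith
    qed
  qed
  then obtain rn where rn: "\<And>t. t \<ge> 0 \<Longrightarrow> norm (\<nu> i t) \<le> rn" by (auto simp: bounded_iff)
  have "\<exists>r. \<forall>i. \<forall>t\<ge>0. norm (u i t) \<le> r"
  proof -
    have "\<exists>r. \<forall>t\<ge>0. norm (u i t) \<le> r" for i using u[of i] by (auto simp: bounded_iff)
    then obtain r where r: "\<And>i t. t \<ge> 0 \<Longrightarrow> norm (u i t) \<le> r i" by metis
    have "r i \<le> Max (range r)" for i by (intro Max_ge) auto
    with r show ?thesis by (meson order_trans)
  qed
  then obtain ru where ru: "\<And>i t. t \<ge> 0 \<Longrightarrow> norm (u i t) \<le> ru" by blast
  \<comment> \<open>The mean of \<open>z\<close> is conserved, and the deviation of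
    \<open>z i\<close> from it is the input disagreement minus \<nu>, both already bounded.\<close>
  have "\<exists>a. \<forall>t\<in>{0..}. mean (\<lambda>j. z j t) = a"
    by (rule has_derivative_zero_constant) (use d_mean_z in \<open>auto simp: has_vector_derivative_def\<close>)
  then obtain a where a: "\<And>t. t \<ge> 0 \<Longrightarrow> mean (\<lambda>j. z j t) = a" by auto
  have "norm (z i t) \<le> 2 * ru + rn + norm a" if t: "t \<ge> 0" for t
  proof -
    have "z i t = (u i t - mean (\<lambda>j. u j t)) - \<nu> i t + a" using a[OF t] by (simp add: \<nu>_def)
    moreover have "norm (mean (\<lambda>j. u j t)) \<le> ru" using ru[OF t] by (rule norm_mean_le)
    ultimately show ?thesis
      using ru[OF t, of i] rn[OF t] norm_triangle_ineq4[of "u i t" "mean (\<lambda>j. u j t)"]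
        norm_triangle_ineq4[of "u i t - mean (\<lambda>j. u j t)" "\<nu> i t"]
        norm_triangle_ineq[of "u i t - mean (\<lambda>j. u j t) - \<nu> i t" a] by simp
  qed
  then show "bounded (z i ` {0..})" by (intro boundedI) auto
qed

end

section \<open>Existence of closed-loop solutions\<close>

lemma average_eq_mean: "average x = mean (\<lambda>i. x $ i)"
  by (simp add: average_def mean_def)

lemma norm_vec_le_sum:
  fixes x :: "'a::real_normed_vector ^ 'm"
  assumes "\<And>i. norm (x $ i) \<le> k i"
  shows "norm x \<le> (\<Sum>i\<in>UNIV. k i)"
  unfolding norm_vec_def
  by (rule order_trans[OF L2_set_le_sum]) (simp, rule sum_mono, rule assms)

lemma norm_average_le: "norm (average x) \<le> norm x"
  unfolding average_eq_mean by (rule norm_mean_le) (rule Finite_Cartesian_Product.norm_nth_le)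

lemma bounded_vec_image:
  fixes x :: "real \<Rightarrow> 'a::real_normed_vector ^ 'm"
  assumes "\<And>i. bounded ((\<lambda>t. x t $ i) ` S)"
  shows "bounded (x ` S)"
proof -
  have "\<exists>r. \<forall>t\<in>S. norm (x t $ i) \<le> r" for i using assms[of i] by (auto simp: bounded_iff)
  then obtain r where r: "\<And>i t. t \<in> S \<Longrightarrow> norm (x t $ i) \<le> r i" by metis
  have "norm (x t) \<le> (\<Sum>i\<in>UNIV. r i)" if "t \<in> S" for t
    by (rule norm_vec_le_sum, rule r[OF that])
  then show ?thesis by (auto intro: boundedI)
qed

lemma continuous_on_saturate:
  assumes "continuous_on S R" "continuous_on S f" "\<And>t. t \<in> S \<Longrightarrow> R t > 0"
  shows "continuous_on S (\<lambda>t. saturate (R t) (f t))"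
  unfolding saturate_def
  by (intro continuous_intros assms) (use assms(3) in force)

text \<open>On the ball of radius \<open>r\<close> the gradient contributes
  \<open>\<theta> * r\<close> and the quadratic remainder \<open>2 * \<theta> * r\<close>, as
  \<open>norm (x - y)\<close> is at most \<open>2 * r\<close>. The growth with \<open>r\<close> is
  why the existence proof truncates.\<close>

lemma lipschitz_gradient_diff_le:
  fixes h :: "'a::real_inner \<Rightarrow> real"
  assumes grad: "\<And>x. GDERIV h x :> D x"
    and lip: "\<And>x y. norm (D x - D y) \<le> \<theta> * norm (x - y)" and "\<theta> > 0" and "D 0 = 0"
    and "norm x \<le> r" "norm y \<le> r"
  shows "\<bar>h x - h y\<bar> \<le> 3 * \<theta> * r * norm (x - y)"
proof -
  have "\<bar>D y \<bullet> (x - y)\<bar> \<le> (\<theta> * r) * norm (x - y)"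
  proof (rule order_trans[OF Cauchy_Schwarz_ineq2], rule mult_right_mono)
    show "norm (D y) \<le> \<theta> * r"
      using lip[of y 0] \<open>D 0 = 0\<close> mult_left_mono[OF \<open>norm y \<le> r\<close>, of \<theta>] \<open>\<theta> > 0\<close>
      by (metis diff_zero less_imp_le order_trans)
  qed simp
  moreover have "\<theta> * (norm (x - y))\<^sup>2 \<le> \<theta> * (2 * r) * norm (x - y)"
  proof -
    have "norm (x - y) \<le> 2 * r"
      using norm_triangle_ineq4[of x y] assms(5,6) by linarith
    then have "\<theta> * norm (x - y) * norm (x - y) \<le> \<theta> * (2 * r) * norm (x - y)"
      using \<open>\<theta> > 0\<close> by (intro mult_right_mono mult_left_mono) auto
    then show ?thesis by (simp add: power2_eq_square mult.assoc)
  qed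
  moreover have "\<bar>h x - h y - D y \<bullet> (x - y)\<bar> \<le> \<theta> * (norm (x - y))\<^sup>2"
    using lipschitz_gradient_remainder_le[OF grad lip \<open>\<theta> > 0\<close>, of y "x - y"] by simp
  ultimately show ?thesis by (simp add: algebra_simps)
qed

text \<open>The speed is bounded and the formation error is bounded a priori, so \<open>norm (p t $ i)\<close> stays below an affine
  function \<open>R t\<close> of time. Truncating the argument of \<open>h\<close> at radius \<open>R t\<close> makes the vector field globally
  Lipschitz without changing the solution.\<close>
lemma closed_loop_exists:
  fixes h :: "real^'n \<Rightarrow> real" and w :: "'m::finite \<Rightarrow> real^'n" and V :: "real^'n^'n"
    and p0 \<delta>0 q0 :: "real^'n^'m"
  assumes grad: "\<And>x. GDERIV h x :> D x"
    and lip: "\<And>x y. norm (D x - D y) \<le> \<theta> * norm (x - y)" and "\<theta> > 0" and "D 0 = 0"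
    and w: "mean w = 0" and c: "c > 0"
  shows "\<exists>p \<delta> q. (\<forall>t\<ge>0. \<forall>i.
    ((\<lambda>s. p s $ i) has_vector_derivative
      - c *\<^sub>R saturate 1 (V *v (\<delta> t $ i)) - (p t $ i - average (p t) - w i)) (at t within {0..}) \<and>
    ((\<lambda>s. \<delta> s $ i) has_vector_derivative
      - (\<delta> t $ i - (real CARD('m) * h (p t $ i)) *\<^sub>R w i) - (q t $ i - average (q t))) (at t within {0..}) \<and>
    ((\<lambda>s. q s $ i) has_vector_derivative k *\<^sub>R (\<delta> t $ i - average (\<delta> t))) (at t within {0..})) \<and>
    p 0 = p0 \<and> \<delta> 0 = \<delta>0 \<and> q 0 = q0"
proof -
  define e0 where "e0 i = p0 $ i - average p0 - w i" for i
  \<comment> \<open>The bound of \<open>norm_p_le\<close> with sums in place of the terms of agent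
    \<open>i\<close>, so that one radius serves all agents.\<close>
  define R where "R t = norm (average p0) + (\<Sum>i\<in>UNIV. norm (w i)) + 2 * c + (\<Sum>i\<in>UNIV. norm (e0 i)) + c * t" for t
  have Rpos: "R t > 0" if "t \<ge> 0" for t
    unfolding R_def using that c by (intro add_pos_nonneg add_nonneg_pos) (auto intro!: sum_nonneg add_nonneg_nonneg)
  have Rcont: "continuous_on S R" for S
    unfolding R_def by (intro continuous_intros)
  define H where "H t x i = (real CARD('m) * h (saturate (R t) (x $ i))) *\<^sub>R w i"
    for t and x :: "real^'n^'m" and i
  define F where "F t x =
    ((\<chi> i. - c *\<^sub>R saturate 1 (V *v (fst (snd x) $ i)) - (fst x $ i - average (fst x) - w i)) :: real^'n^'m,
     (\<chi> i. - (fst (snd x) $ i - H t (fst x) i) - (snd (snd x) $ i - average (snd (snd x)))) :: real^'n^'m,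
     (\<chi> i. k *\<^sub>R (fst (snd x) $ i - average (fst (snd x)))) :: real^'n^'m)"
    for t and x :: "(real^'n^'m) \<times> (real^'n^'m) \<times> (real^'n^'m)"
  obtain K where K: "K > 0" "\<And>x. norm (V *v x) \<le> norm x * K"
    using bounded_linear.pos_bounded[OF matrix_vector_mul_bounded_linear[of V]] by blast
  \<comment> \<open>Componentwise Lipschitz constants summed over the agents. The term
    \<open>norm (F 0 0)\<close> lets \<open>L\<close> also dominate the field at the origin, which
    is constant in time because truncation fixes 0.\<close>
  define L where "L t = (\<Sum>i\<in>(UNIV::'m set). (c * (2 * K) + 2) + (3 + real CARD('m) * (3 * \<theta> * R t * 2) * norm (w i))
      + \<bar>k\<bar> * 2) + norm (F 0 0)" for t
  have "\<exists>x. x 0 = (p0, \<delta>0, q0) \<and> (\<forall>t\<ge>0. (x has_vector_derivative F t (x t)) (at t within {0..}))"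
  proof (rule ode_global_solution)
    show "continuous_on {0..} L" unfolding L_def by (intro continuous_intros Rcont)
    show "L t \<ge> 0" if "t \<ge> 0" for t
      unfolding L_def using that c K(1) Rpos[OF that] \<open>\<theta> > 0\<close>
      by (intro add_nonneg_nonneg sum_nonneg mult_nonneg_nonneg) auto
    show "norm (F t 0) \<le> L t" if t: "t \<ge> 0" for t
    proof -
      have "F t 0 = F 0 0" by (simp add: F_def H_def saturate_def)
      moreover have "L t - norm (F 0 0) \<ge> 0"
        unfolding L_def using c K(1) Rpos[OF t] \<open>\<theta> > 0\<close>
        by (simp, intro sum_nonneg add_nonneg_nonneg mult_nonneg_nonneg) auto
      ultimately show ?thesis by simp
    qed
    show "continuous_on {0..} (\<lambda>t. F t (z t))" if z: "continuous_on {0..} z" for z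
    proof -
      have "continuous_on UNIV h"
        using grad by (auto simp: gderiv_def continuous_on_eq_continuous_at intro: has_derivative_continuous)
      then have h: "continuous_on {0..} (\<lambda>t. h (f t))" if "continuous_on {0..} f" for f :: "real \<Rightarrow> real^'n"
        by (rule continuous_on_compose2) (use that in auto)
      have V: "continuous_on {0..} (\<lambda>t. V *v f t)" if "continuous_on {0..} f" for f :: "real \<Rightarrow> real^'n"
        by (rule bounded_linear.continuous_on[OF matrix_vector_mul_bounded_linear that])
      show ?thesis
        unfolding F_def H_def average_def
        by (intro continuous_intros continuous_on_vec_lambda continuous_on_component continuous_on_saturate h V Rcont z)
          (auto intro: Rpos)
    qed
    show "norm (F t x - F t y) \<le> L t * norm (x - y)" if t: "t \<ge> 0" for t x y
    proof -
      define d where "d = norm (x - y)"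
      have fst_le: "norm (fst v) \<le> norm v" and snd_le: "norm (snd v) \<le> norm v"
        for v :: "'a::real_normed_vector \<times> 'b::real_normed_vector"
        by (metis norm_fst_le prod.collapse) (metis norm_snd_le prod.collapse)
      have le_sum: "norm v \<le> norm (fst v) + norm (snd v)"
        for v :: "'a::real_normed_vector \<times> 'b::real_normed_vector"
        by (metis norm_Pair_le prod.collapse)
      have nx: "norm (fst x - fst y) \<le> d" "norm (fst (snd x) - fst (snd y)) \<le> d"
          "norm (snd (snd x) - snd (snd y)) \<le> d"
        using fst_le[of "x - y"] snd_le[of "x - y"] fst_le[of "snd (x - y)"] snd_le[of "snd (x - y)"]
        by (simp_all add: d_def)
      have nth: "norm (a $ i - b $ i) \<le> d" and av: "norm (average a - average b) \<le> d"
        if "norm (a - b) \<le> d" for a b :: "real^'n^'m" and i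
      proof -
        show "norm (a $ i - b $ i) \<le> d"
          using Finite_Cartesian_Product.norm_nth_le[of "a - b" i] that by simp
        have "average a - average b = average (a - b)" by (simp add: average_eq_mean mean_diff)
        then show "norm (average a - average b) \<le> d" using norm_average_le[of "a - b"] that by simp
      qed
      have diff: "norm ((a $ i - average a) - (b $ i - average b)) \<le> 2 * d"
        if "norm (a - b) \<le> d" for a b :: "real^'n^'m" and i
      proof -
        have eq: "(a $ i - average a) - (b $ i - average b) = (a $ i - b $ i) - (average a - average b)" by simp
        show ?thesis
          unfolding eq using nth[OF that, of i] av[OF that] norm_triangle_ineq4[of "a $ i - b $ i" "average a - average b"]
          by linarith
      qed
      have d0: "d \<ge> 0" by (simp add: d_def)
      have 1: "norm (fst (F t x) $ i - fst (F t y) $ i) \<le> (c * (2 * K) + 2) * d" for i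
      proof -
        let ?a = "fst (snd x) $ i" and ?b = "fst (snd y) $ i"
        have "norm (saturate 1 (V *v ?a) - saturate 1 (V *v ?b)) \<le> 2 * norm (V *v (?a - ?b))"
          using saturate_lipschitz[of 1 "V *v ?a" "V *v ?b"] by (simp add: matrix_vector_mult_diff_distrib)
        also have "\<dots> \<le> 2 * (d * K)"
          using K(2)[of "?a - ?b"] mult_right_mono[OF nth[OF nx(2), of i], of K] K(1) by linarith
        finally have b1: "norm (c *\<^sub>R (saturate 1 (V *v ?b) - saturate 1 (V *v ?a))) \<le> c * (2 * (d * K))"
          using c by (simp add: norm_minus_commute)
        have eq: "fst (F t x) $ i - fst (F t y) $ i = c *\<^sub>R (saturate 1 (V *v ?b) - saturate 1 (V *v ?a))
            - ((fst x $ i - average (fst x)) - (fst y $ i - average (fst y)))"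
          by (simp add: F_def scaleR_diff_right)
        have "norm (fst (F t x) $ i - fst (F t y) $ i) \<le> c * (2 * (d * K)) + 2 * d"
          unfolding eq by (rule norm_triangle_le_diff, rule add_mono[OF b1 diff[OF nx(1)]])
        then show ?thesis by (simp add: algebra_simps)
      qed
      have 2: "norm (fst (snd (F t x)) $ i - fst (snd (F t y)) $ i)
          \<le> (3 + real CARD('m) * (3 * \<theta> * R t * 2) * norm (w i)) * d" for i
      proof -
        let ?a = "saturate (R t) (fst x $ i)" and ?b = "saturate (R t) (fst y $ i)"
        have "\<bar>h ?a - h ?b\<bar> \<le> 3 * \<theta> * R t * norm (?a - ?b)"
          by (rule lipschitz_gradient_diff_le[OF grad lip \<open>\<theta> > 0\<close> \<open>D 0 = 0\<close>]; rule norm_saturate_le[OF Rpos[OF t]])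
        also have "\<dots> \<le> 3 * \<theta> * R t * (2 * d)"
          using saturate_lipschitz[OF Rpos[OF t], of "fst x $ i" "fst y $ i"] nth[OF nx(1), of i] Rpos[OF t] \<open>\<theta> > 0\<close>
          by (intro mult_left_mono) auto
        finally have b2: "norm ((real CARD('m) * (h ?a - h ?b)) *\<^sub>R w i) \<le> real CARD('m) * (3 * \<theta> * R t * (2 * d)) * norm (w i)"
          unfolding norm_scaleR real_norm_def abs_mult by (intro mult_right_mono mult_mono) auto
        have eqH: "H t (fst x) i - H t (fst y) i = (real CARD('m) * (h ?a - h ?b)) *\<^sub>R w i"
          by (simp add: H_def scaleR_diff_left right_diff_distrib)
        have eq: "fst (snd (F t x)) $ i - fst (snd (F t y)) $ i = (H t (fst x) i - H t (fst y) i)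
            - ((fst (snd x) $ i - fst (snd y) $ i)
              + ((snd (snd x) $ i - average (snd (snd x))) - (snd (snd y) $ i - average (snd (snd y)))))"
          by (simp add: F_def)
        have "norm (fst (snd (F t x)) $ i - fst (snd (F t y)) $ i)
            \<le> real CARD('m) * (3 * \<theta> * R t * (2 * d)) * norm (w i) + (d + 2 * d)"
          unfolding eq eqH
          by (rule norm_triangle_le_diff, rule add_mono[OF b2 norm_triangle_le],
              rule add_mono[OF nth[OF nx(2)] diff[OF nx(3)]])
        then show ?thesis by (simp add: algebra_simps)
      qed
      have 3: "norm (snd (snd (F t x)) $ i - snd (snd (F t y)) $ i) \<le> \<bar>k\<bar> * 2 * d" for i
      proof -
        have "snd (snd (F t x)) $ i - snd (snd (F t y)) $ i =
            k *\<^sub>R ((fst (snd x) $ i - average (fst (snd x))) - (fst (snd y) $ i - average (fst (snd y))))"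
          by (simp add: F_def scaleR_diff_right)
        then show ?thesis using mult_left_mono[OF diff[OF nx(2), of i], of "\<bar>k\<bar>"] by simp
      qed
      have "norm (F t x - F t y) \<le> norm (fst (F t x) - fst (F t y)) + (norm (fst (snd (F t x)) - fst (snd (F t y)))
          + norm (snd (snd (F t x)) - snd (snd (F t y))))"
        using le_sum[of "F t x - F t y"] le_sum[of "snd (F t x - F t y)"] by simp
      also have "\<dots> \<le> (\<Sum>i\<in>(UNIV::'m set). (c * (2 * K) + 2) * d) +
          ((\<Sum>i\<in>(UNIV::'m set). (3 + real CARD('m) * (3 * \<theta> * R t * 2) * norm (w i)) * d) + (\<Sum>i\<in>(UNIV::'m set). \<bar>k\<bar> * 2 * d))"
        by (intro add_mono norm_vec_le_sum) (simp_all only: vector_minus_component 1 2 3)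
      also have "\<dots> = (L t - norm (F 0 0)) * d"
        by (simp only: L_def add_diff_cancel_right' sum_distrib_right sum.distrib[symmetric])
          (simp only: distrib_right add.assoc)
      also have "\<dots> \<le> L t * d" using d0 by (intro mult_right_mono) auto
      finally show ?thesis by (simp add: d_def)
    qed
  qed
  then obtain x where x0: "x 0 = (p0, \<delta>0, q0)"
    and x: "\<And>t. t \<ge> 0 \<Longrightarrow> (x has_vector_derivative F t (x t)) (at t within {0..})" by blast
  define p \<delta> q where "p t = fst (x t)" and "\<delta> t = fst (snd (x t))" and "q t = snd (snd (x t))" for t
  have d: "((\<lambda>s. p s $ i) has_vector_derivative fst (F t (x t)) $ i) (at t within {0..})"
    "((\<lambda>s. \<delta> s $ i) has_vector_derivative fst (snd (F t (x t))) $ i) (at t within {0..})"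
    "((\<lambda>s. q s $ i) has_vector_derivative snd (snd (F t (x t))) $ i) (at t within {0..})" if "t \<ge> 0" for t i
    unfolding p_def \<delta>_def q_def
    by (intro bounded_linear.has_vector_derivative[OF bounded_linear_vec_nth]
        bounded_linear.has_vector_derivative[OF bounded_linear_fst]
        bounded_linear.has_vector_derivative[OF bounded_linear_snd] x that)+
  \<comment> \<open>Truncation leaves the position equation untouched, so the a priori bound holds
    for the truncated solution. It keeps every position within \<open>R t\<close>, where truncation
    is the identity.\<close>
  interpret formation "\<lambda>i t. p t $ i" "\<lambda>i t. - c *\<^sub>R saturate 1 (V *v (\<delta> t $ i))" w c
  proof
    fix t :: real and i assume "t \<ge> 0"
    then show "((\<lambda>t. p t $ i) has_vector_derivative - c *\<^sub>R saturate 1 (V *v (\<delta> t $ i))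
        - (p t $ i - mean (\<lambda>j. p t $ j) - w i)) (at t within {0..})"
      using d(1)[of t i] by (simp add: F_def average_eq_mean flip: p_def \<delta>_def)
    show "norm (- c *\<^sub>R saturate 1 (V *v (\<delta> t $ i))) \<le> c"
      using c norm_saturate_le[of 1 "V *v (\<delta> t $ i)"] by simp
  qed (rule w c)+
  have p_le: "norm (p t $ i) \<le> R t" if "t \<ge> 0" for t i
  proof -
    have "p 0 = p0" by (simp add: p_def x0)
    then have "center 0 = average p0" "err i 0 = e0 i"
      by (simp_all add: center_def err_def e0_def average_eq_mean)
    moreover have "norm (w i) \<le> (\<Sum>i\<in>UNIV. norm (w i))" "norm (e0 i) \<le> (\<Sum>i\<in>UNIV. norm (e0 i))"
      by (rule member_le_sum; simp)+
    ultimately show ?thesis using norm_p_le[OF that, of i] by (simp add: R_def)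
  qed
  have "H t (p t) i = (real CARD('m) * h (p t $ i)) *\<^sub>R w i" if "t \<ge> 0" for t i
    by (simp add: H_def saturate_eq[OF Rpos[OF that] p_le[OF that]])
  then show ?thesis
    using d by (intro exI[of _ p] exI[of _ \<delta>] exI[of _ q]) (simp add: F_def p_def \<delta>_def q_def x0)
qed

section \<open>Choice of the coefficients\<close>

text \<open>Along the segment from the identity to \<open>A\<close> the quadratic form stays
  positive, so no matrix on it is singular; the determinant starts at 1 and cannot change
  sign.\<close>

lemma det_pos_if_positive_definite:
  fixes A :: "real^'n^'n"
  assumes "\<And>x. x \<noteq> 0 \<Longrightarrow> x \<bullet> (A *v x) > 0"
  shows "det A > 0"
proof (rule ccontr)
  assume "\<not> det A > 0"
  define M where "M t = (1 - t) *\<^sub>R mat 1 + t *\<^sub>R A" for t :: real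
  have M: "M t *v x = (1 - t) *\<^sub>R x + t *\<^sub>R (A *v x)" for t x
    by (simp add: M_def matrix_vector_mult_add_rdistrib flip: scaleR_matrix_vector_assoc)
  have "\<exists>t. 0 \<le> t \<and> t \<le> 1 \<and> det (M t) = 0"
  proof (rule IVT2')
    show "continuous_on {0..1} (\<lambda>t. det (M t))"
      unfolding det_def M_def by (auto intro!: continuous_intros)
  qed (use \<open>\<not> det A > 0\<close> in \<open>auto simp: M_def\<close>)
  then obtain t where t: "0 \<le> t" "t \<le> 1" "det (M t) = 0" by blast
  then obtain x where x: "x \<noteq> 0" "M t *v x = 0"
    by (metis invertible_det_nz invertible_left_inverse matrix_left_invertible_ker)
  have "(1 - t) * (x \<bullet> x) + t * (x \<bullet> (A *v x)) = x \<bullet> (M t *v x)"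
    by (simp add: M inner_add_right)
  then have "(1 - t) * (x \<bullet> x) + t * (x \<bullet> (A *v x)) = 0" using x by simp
  moreover have "(1 - t) * (x \<bullet> x) \<ge> 0" "t * (x \<bullet> (A *v x)) \<ge> 0"
    using t assms[OF x(1)] by auto
  ultimately have "(1 - t) * (x \<bullet> x) = 0" "t * (x \<bullet> (A *v x)) = 0" by linarith+
  then show False using assms[OF x(1)] x(1) by auto
qed

lemma matrix_inv_mult:
  fixes A :: "'a::semiring_1^'n^'n"
  assumes "invertible A"
  shows "matrix_inv A ** A = mat 1" "A ** matrix_inv A = mat 1"
  using someI_ex[OF assms[unfolded invertible_def], folded matrix_inv_def] by simp_all

text \<open>The offset matrix is the frame operator of the center offsets. This form yields both its
  positive definiteness and the dual family.\<close>

lemma offset_matrix_mult: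
  fixes d :: "'m::finite \<Rightarrow> 'm \<Rightarrow> real^'n"
  shows "offset_matrix d *v x = (\<Sum>j\<in>UNIV. (center_offset d j \<bullet> x) *\<^sub>R center_offset d j)"
proof -
  have sum: "(\<Sum>j\<in>S. A j) *v x = (\<Sum>j\<in>S. A j *v x)" if "finite S"
    for S and A :: "'m \<Rightarrow> real^'n^'n"
    using that by induction (simp_all add: matrix_vector_mult_add_rdistrib)
  have outer: "((columnvector v :: real^1^'n) ** rowvector v) *v x = (v \<bullet> x) *\<^sub>R v" for v :: "real^'n"
    by (simp add: vec_eq_iff matrix_vector_mult_def matrix_matrix_mult_def columnvector_def
        rowvector_def inner_vec_def sum_distrib_left mult_ac)
  show ?thesis by (simp add: offset_matrix_def sum outer)
qed

lemma center_offset_diff: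
  fixes x :: "'m::finite \<Rightarrow> real^'n"
  assumes "mean x = 0"
  shows "center_offset (\<lambda>i j. x i - x j) i = x i"
proof -
  have "center_offset (\<lambda>i j. x i - x j) i = mean (\<lambda>j. x i - x j)"
    by (simp add: center_offset_def mean_def)
  then show ?thesis by (simp add: mean_diff mean_const assms)
qed

text \<open>Give \<open>n\<close> agents the axis vectors and all others 0, then subtract the mean.
  At an agent \<open>k\<close> with vector 0 the centered vector is minus the mean, so a vector
  orthogonal to the whole family is orthogonal to the mean and hence to all axes. The surplus agent
  \<open>k\<close> is where \<open>N \<ge> n + 1\<close> enters.\<close>

lemma centered_spanning_family:
  assumes "CARD('m::finite) \<ge> CARD('n) + 1"
  shows "\<exists>\<xi> :: 'm \<Rightarrow> real^'n. mean \<xi> = 0 \<and> (\<forall>x. x \<noteq> 0 \<longrightarrow> (\<Sum>i\<in>UNIV. (\<xi> i \<bullet> x)\<^sup>2) > 0)"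
proof -
  obtain k :: 'm where True by simp
  have "card (UNIV - {k}) = CARD('m) - 1" by simp
  then have "\<exists>f. f ` (UNIV :: 'n set) \<subseteq> UNIV - {k} \<and> inj_on f UNIV"
    using assms by (intro card_le_inj) auto
  then obtain f :: "'n \<Rightarrow> 'm" where f: "\<And>i. f i \<noteq> k" "inj f" by blast
  define e :: "'m \<Rightarrow> real^'n" where "e i = (if i \<in> range f then axis (inv f i) 1 else 0)" for i
  have e: "e (f i) = axis i 1" "e k = 0" for i
    using f(2) by (auto simp: e_def) (metis f(1))
  define \<xi> where "\<xi> i = e i - mean e" for i
  have "mean \<xi> = 0" by (simp add: \<xi>_def[abs_def] mean_diff mean_const)
  moreover have "(\<Sum>i\<in>UNIV. (\<xi> i \<bullet> x)\<^sup>2) > 0" if "x \<noteq> 0" for x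
  proof (rule ccontr)
    assume "\<not> ?thesis"
    then have "(\<Sum>i\<in>UNIV. (\<xi> i \<bullet> x)\<^sup>2) = 0" by (simp add: sum_nonneg antisym not_less)
    then have 0: "\<xi> i \<bullet> x = 0" for i by (simp add: sum_nonneg_eq_0_iff)
    then have "mean e \<bullet> x = 0" using 0[of k] e(2) by (simp add: \<xi>_def)
    then have "e i \<bullet> x = 0" for i using 0[of i] by (simp add: \<xi>_def inner_diff_left)
    then have "x $ i = 0" for i using e(1)[of i] by (metis inner_axis' mult_1 inner_real_def)
    then show False using that by (simp add: vec_eq_iff)
  qed
  ultimately show ?thesis by blast
qed

lemma gradient_at_minimum:
  fixes h :: "'a::real_inner \<Rightarrow> real"
  assumes "GDERIV h x :> D" "\<And>y. h x \<le> h y"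
  shows "D = 0"
proof -
  have "((\<lambda>s. h (x + s *\<^sub>R D)) has_real_derivative D \<bullet> D) (at 0)"
    by (rule GDERIV_chain_within) (auto simp: assms(1) intro!: derivative_eq_intros)
  then have "D \<bullet> D = 0"
    by (rule DERIV_local_min[where d = 1]) (use assms(2) in auto)
  then show ?thesis by simp
qed

text \<open>These weights make both network terms equal to the deviation from the average. All
  disagreement directions then share one characteristic polynomial, and a single \<mu> tunes them
  all.\<close>

lemma closed_loop_solution_complete_graph:
  fixes \<xi> :: "'m::finite \<Rightarrow> real^'n"
  assumes "mean \<xi> = 0"
  shows "closed_loop_solution h (\<lambda>i j. 1) (\<lambda>i j. 1 / real CARD('m)) (\<lambda>i j. \<xi> i - \<xi> j) c \<mu> \<sigma> p \<delta> q \<longleftrightarrow>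
   (\<forall>t\<ge>0. \<forall>i.
    ((\<lambda>s. p s $ i) has_vector_derivative
      - c *\<^sub>R \<sigma> (matrix_inv (offset_matrix (\<lambda>i j. \<xi> i - \<xi> j)) *v (\<delta> t $ i))
      - (p t $ i - average (p t) - \<xi> i)) (at t within {0..}) \<and>
    ((\<lambda>s. \<delta> s $ i) has_vector_derivative
      - (\<delta> t $ i - (real CARD('m) * h (p t $ i)) *\<^sub>R \<xi> i) - (q t $ i - average (q t))) (at t within {0..}) \<and>
    ((\<lambda>s. q s $ i) has_vector_derivative \<mu> *\<^sub>R (\<delta> t $ i - average (\<delta> t))) (at t within {0..}))"
proof -
  have 1: "formation_input (\<lambda>i j. 1) (\<lambda>i j. \<xi> i - \<xi> j) x i = - (x $ i - average x - \<xi> i)" for x i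
  proof -
    have "formation_input (\<lambda>i j. 1) (\<lambda>i j. \<xi> i - \<xi> j) x i = - mean (\<lambda>j. x $ i - x $ j - (\<xi> i - \<xi> j))"
      by (simp add: formation_input_def mean_def)
    then show ?thesis by (simp add: mean_diff mean_const assms average_eq_mean)
  qed
  have 2: "(\<Sum>j\<in>UNIV. (1 / real CARD('m)) *\<^sub>R (x $ i - x $ j)) = x $ i - average x" for x :: "real^'n^'m" and i
  proof -
    have "(\<Sum>j\<in>UNIV. (1 / real CARD('m)) *\<^sub>R (x $ i - x $ j)) = mean (\<lambda>j. x $ i - x $ j)"
      by (simp add: mean_def scaleR_sum_right)
    then show ?thesis by (simp add: mean_diff mean_const average_eq_mean)
  qed
  show ?thesis
    unfolding closed_loop_solution_def 1 2 center_offset_diff[OF assms] seeking_input_def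
    by (simp only: diff_conv_add_uminus[symmetric])
qed

theorem theorem7:
  fixes h :: "real^'n \<Rightarrow> real"
    and grad_h :: "real^'n \<Rightarrow> real^'n"
    and \<omega> \<theta> p\<^sub>\<epsilon> :: real
  assumes "\<And>p. GDERIV h p :> grad_h p"
    and "\<omega> > 0"
    and "\<theta> > 0"
    and "\<And>p1 p2. (p1 - p2) \<bullet> (grad_h p1 - grad_h p2) \<ge> \<omega> * (norm (p1 - p2))\<^sup>2"
    and "\<And>p1 p2. norm (grad_h p1 - grad_h p2) \<le> \<theta> * norm (p1 - p2)"
    and "\<And>p. is_arg_min h (\<lambda>_. True) p \<longleftrightarrow> p = 0"
    and "CARD('m::finite) \<ge> CARD('n) + 1"
    and "p\<^sub>\<epsilon> > 0"
  shows "\<exists>(a :: 'm \<Rightarrow> 'm \<Rightarrow> real) (b :: 'm \<Rightarrow> 'm \<Rightarrow> real) (d :: 'm \<Rightarrow> 'm \<Rightarrow> real^'n)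
            (c\<^sub>0 :: real) (\<mu> :: real) (\<sigma> :: real^'n \<Rightarrow> real^'n).
      (\<forall>i j. a i j \<ge> 0) \<and> (\<forall>i j. b i j \<ge> 0) \<and>
      (\<forall>i j. d i j = - d j i) \<and> det (offset_matrix d) > 0 \<and>
      c\<^sub>0 > 0 \<and> \<mu> > 0 \<and>
      bounded (range \<sigma>) \<and> \<sigma> 0 = 0 \<and> (\<forall>r. r \<noteq> 0 \<longrightarrow> \<sigma> r \<bullet> r > 0) \<and>
      local_lipschitz (UNIV :: real set) UNIV (\<lambda>_. \<sigma>) \<and>
      (\<forall>pinit \<delta>init qinit :: real^'n^'m.
         (\<exists>p \<delta> q. closed_loop_solution h a b d c\<^sub>0 \<mu> \<sigma> p \<delta> q \<and>
                  p 0 = pinit \<and> \<delta> 0 = \<delta>init \<and> q 0 = qinit) \<and>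
         (\<forall>p \<delta> q. closed_loop_solution h a b d c\<^sub>0 \<mu> \<sigma> p \<delta> q \<and>
                  p 0 = pinit \<and> \<delta> 0 = \<delta>init \<and> q 0 = qinit \<longrightarrow>
            bounded (p ` {0..}) \<and> bounded (\<delta> ` {0..}) \<and> bounded (q ` {0..}) \<and>
            Limsup at_top (\<lambda>t. ereal (norm (average (p t)))) \<le> ereal p\<^sub>\<epsilon>))"
proof -
  have D0: "grad_h 0 = 0"
    using assms(6)[of 0] by (intro gradient_at_minimum[OF assms(1)]) (auto simp: is_arg_min_linorder)
  obtain \<xi> :: "'m \<Rightarrow> real^'n" where \<xi>: "mean \<xi> = 0"
    and spanning: "\<And>x. x \<noteq> 0 \<Longrightarrow> (\<Sum>i\<in>UNIV. (\<xi> i \<bullet> x)\<^sup>2) > 0"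
    using centered_spanning_family[OF assms(7)] by blast
  define M where "M r = offset_matrix (\<lambda>i j. r *\<^sub>R \<xi> i - r *\<^sub>R \<xi> j)" for r
  have mean_r: "mean (\<lambda>i. r *\<^sub>R \<xi> i) = 0" for r by (simp add: mean_scaleR \<xi>)
  have M: "M r *v x = r\<^sup>2 *\<^sub>R (\<Sum>i\<in>UNIV. (\<xi> i \<bullet> x) *\<^sub>R \<xi> i)" for r x
    unfolding M_def offset_matrix_mult center_offset_diff[OF mean_r]
    by (simp add: scaleR_sum_right power2_eq_square mult_ac)
  have det_M: "det (M r) > 0" if "r > 0" for r
  proof (rule det_pos_if_positive_definite)
    fix x :: "real^'n" assume "x \<noteq> 0"
    have "x \<bullet> (M r *v x) = r\<^sup>2 * (\<Sum>i\<in>UNIV. (\<xi> i \<bullet> x)\<^sup>2)"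
      by (simp add: M inner_sum_right power2_eq_square inner_commute)
    then show "x \<bullet> (M r *v x) > 0" using spanning[OF \<open>x \<noteq> 0\<close>] that by simp
  qed
  have inv_l: "matrix_inv (M r) *v (M r *v x) = x" and inv_r: "M r *v (matrix_inv (M r) *v x) = x"
    if "r > 0" for r x
  proof -
    have "invertible (M r)" using det_M[OF that] by (simp add: invertible_det_nz)
    then show "matrix_inv (M r) *v (M r *v x) = x" "M r *v (matrix_inv (M r) *v x) = x"
      by (simp_all add: matrix_vector_mul_assoc matrix_inv_mult)
  qed
  \<comment> \<open>The canonical dual frame of \<xi>. Since \<open>M r\<close> is
    \<open>r^2\<close> times \<open>M 1\<close>, it can be taken at size 1, which keeps
    \<open>C\<close> and \<open>K\<close> independent of \<epsilon>.\<close>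
  define g where "g i = matrix_inv (M 1) *v \<xi> i" for i
  have inv_M: "matrix_inv (M r) *v \<xi> i = (1 / r\<^sup>2) *\<^sub>R g i" if "r > 0" for r i
  proof -
    have "M r *v ((1 / r\<^sup>2) *\<^sub>R g i) = M 1 *v g i"
      using that by (simp add: M matrix_vector_mult_scaleR)
    also have "\<dots> = \<xi> i" by (simp add: g_def inv_r)
    finally show ?thesis using inv_l[OF that] by metis
  qed
  have sum_g: "(\<Sum>i\<in>UNIV. g i) = 0"
  proof -
    have "(\<Sum>i\<in>UNIV. g i) = matrix_inv (M 1) *v (\<Sum>i\<in>UNIV. \<xi> i)"
      by (simp add: g_def linear_sum[OF matrix_vector_mul_linear])
    then show ?thesis using \<xi> by (simp add: mean_def)
  qed
  have dual: "(\<Sum>i\<in>UNIV. (\<xi> i \<bullet> x) *\<^sub>R g i) = x" for x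
  proof -
    have "(\<Sum>i\<in>UNIV. (\<xi> i \<bullet> x) *\<^sub>R g i) = matrix_inv (M 1) *v (M 1 *v x)"
      by (simp add: M g_def linear_sum[OF matrix_vector_mul_linear] matrix_vector_mult_scaleR)
    then show ?thesis by (simp add: inv_l)
  qed
  define C where "C = 1 + (\<Sum>i\<in>UNIV. norm (\<xi> i)) + (\<Sum>i\<in>UNIV. norm (g i))"
  have C: "C > 0" "norm (\<xi> i) \<le> C" "norm (g i) \<le> C" for i
  proof -
    have "norm (\<xi> i) \<le> (\<Sum>i\<in>UNIV. norm (\<xi> i))" "norm (g i) \<le> (\<Sum>i\<in>UNIV. norm (g i))"
      by (rule member_le_sum; simp)+
    moreover have "0 \<le> (\<Sum>i\<in>UNIV. norm (\<xi> i))" "0 \<le> (\<Sum>i\<in>UNIV. norm (g i))"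
      by (auto intro: sum_nonneg)
    ultimately show "C > 0" "norm (\<xi> i) \<le> C" "norm (g i) \<le> C" unfolding C_def by linarith+
  qed
  define N where "N = real CARD('m)"
  \<comment> \<open>This is \<open>148 * K1 + K2\<close> written out, because \<epsilon> must be
    known before the locale that defines \<open>K1\<close> and \<open>K2\<close> is
    interpreted.\<close>
  define K where "K = 148 * (9 * N * \<theta> * C * (C + 9)) + N * C * \<theta> * (8 + (C + 8)\<^sup>2)"
  have "N > 0" by (simp add: N_def)
  then have "K > 0" using C(1) \<open>\<theta> > 0\<close> unfolding K_def
    by (intro add_pos_pos mult_pos_pos) (auto simp: add_pos_nonneg)
  \<comment> \<open>The value \<open>1 / 4\<close> is what the growth bound on \<open>B\<close> asks
    for; \<open>\<omega> / (4 * K)\<close> gives \<open>small\<close>.\<close>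
  define \<epsilon> where "\<epsilon> = min (1 / 4) (\<omega> / (4 * K))"
  have \<epsilon>: "0 < \<epsilon>" "\<epsilon> \<le> 1 / 4" using \<open>K > 0\<close> \<open>\<omega> > 0\<close> by (auto simp: \<epsilon>_def)
  have "4 * K * \<epsilon> \<le> 4 * K * (\<omega> / (4 * K))"
    using \<open>K > 0\<close> by (intro mult_left_mono) (auto simp: \<epsilon>_def)
  then have small: "4 * K * \<epsilon> \<le> \<omega>" using \<open>K > 0\<close> by simp
  define \<rho> where "\<rho> = \<epsilon> * p\<^sub>\<epsilon>"
  define c where "c = \<epsilon> * \<rho>"
  have \<rho>_gt_0: "\<rho> > 0" and c: "c > 0" using \<epsilon> \<open>p\<^sub>\<epsilon> > 0\<close> by (simp_all add: \<rho>_def c_def)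
  let ?d = "\<lambda>i j. \<rho> *\<^sub>R \<xi> i - \<rho> *\<^sub>R \<xi> j"
  let ?b = "\<lambda>i j :: 'm. 1 / real CARD('m)"
  note sol_iff = closed_loop_solution_complete_graph[OF mean_r, of h \<rho> c "2 / 9" "saturate 1", folded M_def]
  have existence: "\<exists>p \<delta> q. closed_loop_solution h (\<lambda>i j. 1) ?b ?d c (2 / 9) (saturate 1) p \<delta> q \<and>
      p 0 = pinit \<and> \<delta> 0 = \<delta>init \<and> q 0 = qinit" for pinit \<delta>init qinit :: "real^'n^'m"
    unfolding sol_iff by (rule closed_loop_exists[OF assms(1,5,3) D0 mean_r c])
  have stability: "bounded (p ` {0..}) \<and> bounded (\<delta> ` {0..}) \<and> bounded (q ` {0..}) \<and>
      Limsup at_top (\<lambda>t. ereal (norm (average (p t)))) \<le> ereal p\<^sub>\<epsilon>"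
    if sol: "closed_loop_solution h (\<lambda>i j. 1) ?b ?d c (2 / 9) (saturate 1) p \<delta> q"
    for p \<delta> q :: "real \<Rightarrow> real^'n^'m"
  proof -
    \<comment> \<open>Multiplication by \<open>V\<close> is linear and commutes with averaging over
      the agents, so the estimator equations keep their form for the transformed \<delta> and
      \<open>q\<close>.\<close>
    define V where "V = matrix_inv (M \<rho>)"
    note V_lin = matrix_vector_mul_bounded_linear[of V]
    have V_average: "V *v average x = mean (\<lambda>i. V *v (x $ i))" for x :: "real^'n^'m"
      by (simp add: average_def mean_def linear_sum[OF matrix_vector_mul_linear] matrix_vector_mult_scaleR)
    note sol' = sol[unfolded sol_iff, folded V_def, rule_format]
    interpret seeking "\<lambda>i t. p t $ i" "\<lambda>i t. V *v (\<delta> t $ i)" \<xi> c \<rho> h grad_h \<omega> \<theta> p\<^sub>\<epsilon> \<epsilon> C N g "\<lambda>i t. V *v (q t $ i)"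
    proof
      fix t :: real and i :: 'm assume t: "t \<ge> 0"
      show "((\<lambda>t. p t $ i) has_vector_derivative
          - c *\<^sub>R saturate 1 (V *v (\<delta> t $ i)) - (p t $ i - mean (\<lambda>j. p t $ j) - \<rho> *\<^sub>R \<xi> i)) (at t within {0..})"
        using sol'[OF t, of i] by (simp add: average_eq_mean)
      show "norm (- c *\<^sub>R saturate 1 (V *v (\<delta> t $ i))) \<le> c"
        using c norm_saturate_le[of 1 "V *v (\<delta> t $ i)"] by simp
      have "((\<lambda>s. V *v (\<delta> s $ i)) has_vector_derivative
        V *v (- (\<delta> t $ i - (real CARD('m) * h (p t $ i)) *\<^sub>R \<rho> *\<^sub>R \<xi> i) - (q t $ i - average (q t)))) (at t within {0..})"
        using sol'[OF t, of i] by (intro bounded_linear.has_vector_derivative[OF V_lin]) simp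
      moreover have "V *v (- (\<delta> t $ i - (real CARD('m) * h (p t $ i)) *\<^sub>R \<rho> *\<^sub>R \<xi> i) - (q t $ i - average (q t)))
          = - (V *v (\<delta> t $ i) - (N / \<rho> * h (p t $ i)) *\<^sub>R g i) - (V *v (q t $ i) - mean (\<lambda>j. V *v (q t $ j)))"
      proof -
        have "V *v ((real CARD('m) * h (p t $ i)) *\<^sub>R \<rho> *\<^sub>R \<xi> i) = (N / \<rho> * h (p t $ i)) *\<^sub>R g i"
          using \<rho>_gt_0 by (simp add: matrix_vector_mult_scaleR V_def inv_M[OF \<rho>_gt_0] N_def power2_eq_square)
        then show ?thesis
          by (simp add: matrix_vector_mult_diff_distrib V_average vec.neg)
      qed
      ultimately show "((\<lambda>s. V *v (\<delta> s $ i)) has_vector_derivative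
          - (V *v (\<delta> t $ i) - (N / \<rho> * h (p t $ i)) *\<^sub>R g i) - (V *v (q t $ i) - mean (\<lambda>j. V *v (q t $ j)))) (at t within {0..})"
        by simp
      have "((\<lambda>s. V *v (q s $ i)) has_vector_derivative V *v ((2 / 9) *\<^sub>R (\<delta> t $ i - average (\<delta> t)))) (at t within {0..})"
        using sol'[OF t, of i] by (intro bounded_linear.has_vector_derivative[OF V_lin]) simp
      then show "((\<lambda>s. V *v (q s $ i)) has_vector_derivative
          (2 / 9) *\<^sub>R (V *v (\<delta> t $ i) - mean (\<lambda>j. V *v (\<delta> t $ j)))) (at t within {0..})"
        by (simp add: matrix_vector_mult_diff_distrib matrix_vector_mult_scaleR V_average)
    next
      show "\<omega> * (norm x)\<^sup>2 \<le> x \<bullet> grad_h x" for x using assms(4)[of x 0] D0 by simp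
    qed (use assms D0 C \<epsilon> mean_r c sum_g dual in \<open>simp_all add: N_def \<rho>_def c_def\<close>)
    have small': "4 * (148 * K1 + K2) * \<epsilon> \<le> \<omega>" using small by (simp add: K_def K1_def K2_def)
    have recover: "bounded ((\<lambda>t. x t $ i) ` {0..})" if "bounded ((\<lambda>t. V *v (x t $ i)) ` {0..})"
      for x :: "real \<Rightarrow> real^'n^'m" and i
    proof -
      have "bounded ((*v) (M \<rho>) ` (\<lambda>t. V *v (x t $ i)) ` {0..})"
        using that by (rule bounded_linear_image) simp
      then show ?thesis by (simp add: image_image V_def inv_r[OF \<rho>_gt_0])
    qed
    have "eventually (\<lambda>t. ereal (norm (average (p t))) \<le> ereal p\<^sub>\<epsilon>) at_top"
      using eventually_center_le[OF small'] by (simp add: center_def average_eq_mean)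
    then have "Limsup at_top (\<lambda>t. ereal (norm (average (p t)))) \<le> ereal p\<^sub>\<epsilon>" by (rule Limsup_bounded)
    moreover have "bounded (p ` {0..})" "bounded (\<delta> ` {0..})" "bounded (q ` {0..})"
      by (rule bounded_vec_image, rule states_bounded(1)[OF small'],
          rule bounded_vec_image, rule recover, rule states_bounded(2)[OF small'],
          rule bounded_vec_image, rule recover, rule states_bounded(3)[OF small'])
    ultimately show ?thesis by blast
  qed
  have lips: "local_lipschitz (UNIV :: real set) UNIV (\<lambda>_. saturate 1 :: real^'n \<Rightarrow> real^'n)"
  proof (rule local_lipschitzI)
    fix t :: real and x :: "real^'n"
    have "2-lipschitz_on S (saturate 1)" for S :: "(real^'n) set"
      using saturate_lipschitz[of 1] by (auto intro!: lipschitz_onI simp: dist_norm)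
    then show "\<exists>u>0. \<exists>L. \<forall>t\<in>cball t u \<inter> UNIV. L-lipschitz_on (cball x u \<inter> UNIV) (saturate 1 :: real^'n \<Rightarrow> real^'n)"
      by (intro exI[of _ 1]) auto
  qed
  have "bounded (range (saturate 1 :: real^'n \<Rightarrow> real^'n))"
    by (rule boundedI[of _ 1]) (auto intro: norm_saturate_le)
  moreover have "saturate 1 0 = (0 :: real^'n)" by (simp add: saturate_def)
  moreover have "saturate 1 r \<bullet> r > 0" if "r \<noteq> 0" for r :: "real^'n"
    using that by (simp add: saturate_def max_def)
  moreover have "det (offset_matrix ?d) > 0" using det_M[OF \<rho>_gt_0] by (simp add: M_def)
  ultimately show ?thesis
    using existence stability c lips
    by (intro exI[of _ "\<lambda>i j. 1"] exI[of _ ?b] exI[of _ ?d] exI[of _ c] exI[of _ "2 / 9"] exI[of _ "saturate 1"]) auto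
qed

end
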